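(* Let $(x_n)_{n\ge 1}$ be the LPSA iterates described in the context, and $u_n=P_{A^\perp}x_n$, $v_n=P_A x_n$. Assume that $f$ is $L$-smooth ($\|\nabla f(x)-\nabla f(y)\|\le L\|x-y\|$ for all $x,y\in\mathbb{R}^d$), that $f$ is $\mu$-strongly convex with $\mu>0$ ($f(x)-f(y)\ge\langle\nabla f(y),x-y\rangle+\frac{\mu}{2}\|x-y\|^2$ for all $x,y$), and that the noise covariance satisfies $\|\Sigma(x)-\Sigma(y)\|\le L\|x-y\|$ for all $x,y$. Let $\eta_n=\eta_0 n^{-\alpha}$ and $p_n=\min\{\gamma\eta_n^{\beta},1\}$ with $\gamma>0$, $0<\alpha\le 1$, $0\le\beta<1$ and $\eta_0>2\cdot\mathbb{1}_{\{\alpha=1\}}/\mu$ (and $\eta_0>0$). Then, as $n\to\infty$, $$\mathbb{E}\|u_n-x^\star\|^2=O\big(n^{-\alpha\min\{1,\,2-2\beta\}}\big)\quad\text{and}\quad \mathbb{E}\|v_n\|^2=O\big(n^{-2\alpha(1-\beta)}\big).$$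
   Context: Setting (LPSA, loopless projected stochastic approximation). Let $A$ be a real matrix with $d$ rows; $P_A$ is the orthogonal projection of $\mathbb{R}^d$ onto the column space of $A$, and $P_{A^\perp}=I_d-P_A$ the orthogonal projection onto the null space of $A^\top$. Let $\mathcal D$ be a probability distribution, $f(x)=\mathbb{E}_{\zeta\sim\mathcal D}f(x,\zeta)$, with $\mathbb{E}_{\zeta\sim\mathcal D}\nabla f(x,\zeta)=\nabla f(x)$ (gradients in $x$). Let $x^\star$ be the unique minimizer of $f$ over $\{x\in\mathbb{R}^d: A^\top x=0\}$ (unique under strong convexity); standing assumption: $\nabla f(x^\star)\ne 0$. Starting from a deterministic point $x_1$, for $n\ge 1$ sample $\zeta_n\sim\mathcal D$ and $\omega_n\sim\mathrm{Bernoulli}(p_n)$ (all independent), set $x_{n+1/2}=x_n-\eta_n\nabla f(x_n,\zeta_n)$, and set $x_{n+1}=P_{A^\perp}x_{n+1/2}$ if $\omega_n=1$, $x_{n+1}=x_{n+1/2}$ if $\omega_n=0$. The gradient noise is $\xi_n=\nabla f(x_n)-\nabla f(x_n,\zeta_n)$, a martingale difference with respect to $\mathcal F_n=\sigma(\zeta_k,\omega_k:k<n)$, i.e. $\mathbb{E}[\xi_n\mid\mathcal F_n]=0$, and $\mathbb{E}[\xi_n\xi_n^\top\mid\mathcal F_n]=\Sigma(x_n)$, where $\Sigma(x)$ is the covariance matrix of $\nabla f(x,\zeta)$, $\zeta\sim\mathcal D$. $\|\cdot\|$ is the Euclidean norm for vectors and the spectral norm for matrices. *)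

theory Defs
  imports "HOL-Probability.Probability"
begin

definition grad :: "('a::real_inner \<Rightarrow> real) \<Rightarrow> 'a \<Rightarrow> 'a" where
  "grad h x = (THE g. GDERIV h x :> g)"

lemma grad_eqI:
  assumes "GDERIV h x :> g"
  shows "grad h x = g"
proof -
  have "g' = g" if "GDERIV h x :> g'" for g'
  proof -
    have "(\<lambda>k. k \<bullet> g') = (\<lambda>k. k \<bullet> g)"
      using that assms has_derivative_unique unfolding gderiv_def by blast
    then show ?thesis by (metis vector_eq_ldot)
  qed
  with assms show ?thesis unfolding grad_def by (intro the_equality)
qed

lemma GDERIV_grad:
  fixes h :: "'a::euclidean_space \<Rightarrow> real"
  assumes "h differentiable (at x)"
  shows "GDERIV h x :> grad h x"
proof -
  obtain h' where h': "(h has_derivative h') (at x)"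
    using assms unfolding differentiable_def by blast
  then interpret bounded_linear h' by (rule has_derivative_bounded_linear)
  have "h' k = k \<bullet> (\<Sum>b\<in>Basis. h' b *\<^sub>R b)" for k
  proof -
    have "h' k = h' (\<Sum>b\<in>Basis. (k \<bullet> b) *\<^sub>R b)" by (simp add: euclidean_representation)
    also have "\<dots> = (\<Sum>b\<in>Basis. (k \<bullet> b) * h' b)" by (simp add: sum scaleR)
    finally show ?thesis by (simp add: inner_sum_right mult.commute)
  qed
  then have "GDERIV h x :> (\<Sum>b\<in>Basis. h' b *\<^sub>R b)"
    using h' unfolding gderiv_def by (metis (no_types, lifting) ext)
  then show ?thesis using grad_eqI by metis
qed

definition orth_proj :: "'a::euclidean_space set \<Rightarrow> 'a \<Rightarrow> 'a" where
  "orth_proj S x = (THE y. y \<in> S \<and> (\<forall>s\<in>S. orthogonal (x - y) s))"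

lemma orth_proj_eqI:
  assumes "subspace S" "y \<in> S" "\<And>s. s \<in> S \<Longrightarrow> orthogonal (x - y) s"
  shows "orth_proj S x = y"
  unfolding orth_proj_def
proof (rule the_equality)
  fix y' assume y': "y' \<in> S \<and> (\<forall>s\<in>S. orthogonal (x - y') s)"
  have "y' - y \<in> S" using assms(1,2) y' by (simp add: subspace_diff)
  then have "(x - y) \<bullet> (y' - y) = 0" "(x - y') \<bullet> (y' - y) = 0"
    using assms(3) y' by (auto simp: orthogonal_def)
  then have "(y' - y) \<bullet> (y' - y) = 0" by (simp add: inner_diff_left)
  then show "y' = y" by simp
qed (use assms in auto)

lemma orth_proj_props:
  assumes "subspace S"
  shows orth_proj_in: "orth_proj S x \<in> S"
    and orth_proj_orthogonal: "s \<in> S \<Longrightarrow> orthogonal (x - orth_proj S x) s"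
proof -
  obtain y z where "y \<in> span S" "\<And>w. w \<in> span S \<Longrightarrow> orthogonal z w" "x = y + z"
    using orthogonal_subspace_decomp_exists by blast
  moreover have "span S = S" using assms by (simp add: span_eq_iff)
  moreover from calculation have "orth_proj S x = y" by (intro orth_proj_eqI assms) auto
  ultimately show "orth_proj S x \<in> S" "s \<in> S \<Longrightarrow> orthogonal (x - orth_proj S x) s" by auto
qed

definition proj_col :: "real^'m^'d \<Rightarrow> real^'d \<Rightarrow> real^'d" where
  "proj_col A = orth_proj (span (columns A))"

definition proj_perp :: "real^'m^'d \<Rightarrow> real^'d \<Rightarrow> real^'d" where
  "proj_perp A x = x - proj_col A x"

lemma transpose_null_iff:
  fixes A :: "real^'m^'d"
  shows "transpose A *v y = 0 \<longleftrightarrow> (\<forall>s\<in>span (columns A). orthogonal y s)"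
proof -
  have "(transpose A *v y) $ i = y \<bullet> column i A" for i
    by (simp add: matrix_vector_mult_def transpose_def column_def inner_vec_def mult.commute)
  then have "transpose A *v y = 0 \<longleftrightarrow> (\<forall>c\<in>columns A. orthogonal y c)"
    unfolding vec_eq_iff[of _ 0] columns_def orthogonal_def by auto
  also have "\<dots> \<longleftrightarrow> (\<forall>s\<in>span (columns A). orthogonal y s)"
    by (meson orthogonal_to_span span_base)
  finally show ?thesis .
qed

lemma proj_perp_eq: "proj_perp A = orth_proj {y. transpose A *v y = 0}"
proof
  fix x
  let ?N = "{y. transpose A *v y = 0}"
  have N: "subspace ?N"
    by (auto simp del: transpose_matrix_vector
        simp: subspace_def matrix_vector_right_distrib matrix_vector_mult_scaleR)
  have "orth_proj ?N x = proj_perp A x"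
  proof (rule orth_proj_eqI[OF N])
    show "proj_perp A x \<in> ?N"
      unfolding mem_Collect_eq transpose_null_iff proj_perp_def proj_col_def
      by (simp add: orth_proj_orthogonal)
    show "orthogonal (x - proj_perp A x) s" if "s \<in> ?N" for s
      using that orth_proj_in[OF subspace_span, of "columns A" x]
      unfolding mem_Collect_eq transpose_null_iff proj_perp_def proj_col_def
      by (subst orthogonal_commute) simp
  qed
  then show "proj_perp A x = orth_proj ?N x" by simp
qed

definition cov_matrix :: "'z measure \<Rightarrow> ('z \<Rightarrow> real^'d) \<Rightarrow> real^'d^'d" where
  "cov_matrix D g =
    (\<chi> i j. \<integral>z. (g z $ i - (\<integral>z'. g z' \<partial>D) $ i) * (g z $ j - (\<integral>z'. g z' \<partial>D) $ j) \<partial>D)"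

text \<open>
  The probability space \<open>M\<close> carries the samples \<open>\<zeta> n\<close> and the coin flips \<open>\<omega> n\<close> for \<open>n \<ge> 1\<close>;
  values at index \<open>0\<close> are unconstrained. \<open>indep_vars\<close> needs a common value type, so mutual
  independence of all \<open>\<zeta> n\<close> and \<open>\<omega> n\<close> is stated for the sigma-algebras they generate, with
  \<open>Inl n\<close> indexing \<open>\<zeta> n\<close> and \<open>Inr n\<close> indexing \<open>\<omega> n\<close>.
  Finiteness of \<open>E \<parallel>\<nabla>F(x, \<zeta>)\<parallel>\<^sup>2\<close> is what makes the noise covariance exist.
\<close>

locale lpsa =
  prob_space M + D: prob_space D
  for M :: "'w measure" and D :: "'z measure" +
  fixes A :: "real^'m^'d"
    and F :: "real^'d \<Rightarrow> 'z \<Rightarrow> real"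
    and f :: "real^'d \<Rightarrow> real"
    and \<eta> p :: "nat \<Rightarrow> real"
    and \<zeta> :: "nat \<Rightarrow> 'w \<Rightarrow> 'z"
    and \<omega> :: "nat \<Rightarrow> 'w \<Rightarrow> bool"
    and x\<^sub>1 :: "real^'d"
    and x :: "nat \<Rightarrow> 'w \<Rightarrow> real^'d"
  assumes F_integrable: "\<And>y. integrable D (F y)"
    and f_eq: "\<And>y. f y = (\<integral>z. F y z \<partial>D)"
    and F_differentiable: "\<And>y z. z \<in> space D \<Longrightarrow> (\<lambda>y. F y z) differentiable (at y)"
    and f_differentiable: "\<And>y. f differentiable (at y)"
    and grad_integrable: "\<And>y. integrable D (\<lambda>z. grad (\<lambda>y. F y z) y)"
    and grad_unbiased: "\<And>y. (\<integral>z. grad (\<lambda>y. F y z) y \<partial>D) = grad f y"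
    and grad_square_integrable: "\<And>y. integrable D (\<lambda>z. (norm (grad (\<lambda>y. F y z) y))\<^sup>2)"
    and \<zeta>_measurable: "\<And>n. n \<ge> 1 \<Longrightarrow> \<zeta> n \<in> measurable M D"
    and \<zeta>_distr: "\<And>n. n \<ge> 1 \<Longrightarrow> distr M D (\<zeta> n) = D"
    and \<omega>_measurable: "\<And>n. n \<ge> 1 \<Longrightarrow> \<omega> n \<in> measurable M (count_space UNIV)"
    and \<omega>_distr: "\<And>n. n \<ge> 1 \<Longrightarrow>
          distr M (count_space UNIV) (\<omega> n) = measure_pmf (bernoulli_pmf (p n))"
    and indep: "indep_sets
          (case_sum (\<lambda>n. sets (vimage_algebra (space M) (\<zeta> n) D))
                    (\<lambda>n. sets (vimage_algebra (space M) (\<omega> n) (count_space UNIV))))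
          (Inl ` {1..} \<union> Inr ` {1..})"
    and x_init: "\<And>w. w \<in> space M \<Longrightarrow> x 1 w = x\<^sub>1"
    and x_step: "\<And>n w. n \<ge> 1 \<Longrightarrow> w \<in> space M \<Longrightarrow>
          x (Suc n) w =
            (let x_half = x n w - \<eta> n *\<^sub>R grad (\<lambda>y. F y (\<zeta> n w)) (x n w)
             in if \<omega> n w then proj_perp A x_half else x_half)"

end

theory Submission
  imports Defs
begin

text \<open>
Write \<open>u\<close> and \<open>v\<close> for the components of an iterate \<open>x\<close> in the null space of \<open>A\<^sup>T\<close> and in
the column space of \<open>A\<close>, and let \<open>U\<close> and \<open>V\<close> be the mean squares of \<open>u - xstar\<close> and of \<open>v\<close>.

The coin does not influence \<open>u\<close>: with or without the projection, \<open>u\<close> moves by \<open>-\<eta>\<close> times the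
projected stochastic gradient. Since \<open>grad f xstar\<close> is orthogonal to the null space,
\<open>u - xstar\<close> sees only gradient differences, and strong convexity contracts it up to a
cross term with \<open>v\<close> (\<open>perp_descent\<close>). The component \<open>v\<close> is reset to \<open>0\<close> with probability \<open>p\<close>,
and otherwise drifts by \<open>\<eta>\<close> times a gradient that need not vanish near \<open>xstar\<close> (\<open>col_drift\<close>).
The Lipschitz bound on the covariance controls its trace, so the second moment of the stochastic
gradient is at most \<open>B (1 + \<parallel>x - xstar\<parallel>\<^sup>2)\<close> (\<open>second_moment_growth\<close>). As an iterate depends only on
earlier samples and coins, taking expectations gives, for all late steps and a constant \<open>C\<close>
(\<open>mean_square_recursion\<close>),

  \<open>U' \<le> (1 - \<mu> \<eta>) U + C \<eta> V + C \<eta>\<^sup>2\<close>  and  \<open>V' \<le> (1 - p / 2) V + C p (\<eta> / p)\<^sup>2 (1 + U)\<close>.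

These two inequalities determine the rates. The feedback from \<open>V\<close> to \<open>U\<close> is of bounded
relative strength, whereas the feedback from \<open>U\<close> to \<open>V\<close> carries the factor \<open>(\<eta> / p)\<^sup>2\<close>, which tends
to \<open>0\<close>; hence both sequences stay bounded (\<open>coupled_recursion_bounded\<close>). With \<open>U\<close> bounded, the
second inequality balances at \<open>V\<close> of order \<open>(\<eta> / p)\<^sup>2\<close>, that is \<open>n powr (-2 \<alpha> (1 - \<beta>))\<close>; with this
\<open>V\<close>, the first one balances at \<open>U\<close> of order \<open>V + \<eta>\<close>, so that the slower of the two decays prevails.
A recursion follows such a balance as soon as its contraction factors beat the decay of the
forcing term, which is Chung's lemma (\<open>chung_recursion\<close>). This is automatic for \<open>V\<close>, and for \<open>U\<close>
when \<open>\<alpha> < 1\<close>; when \<open>\<alpha> = 1\<close>, the lower bound on \<open>\<eta>\<^sub>0\<close> makes it true for \<open>U\<close>.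
\<close>

section \<open>Linear recursions with polynomial rates\<close>

lemma powr_succ_lower_bound:
  fixes s :: real
  assumes "s \<ge> 0" "n \<ge> 1"
  shows "real n powr (-s) * (1 - s / real n) \<le> real (Suc n) powr (-s)"
proof -
  have eq: "real (Suc n) = real n * (1 + 1 / real n)"
    using assms by (simp add: field_simps)
  have pos: "1 + 1 / real n > 0"
    by (simp add: add_pos_nonneg)
  have "1 - s / real n \<le> 1 - s * ln (1 + 1 / real n)"
    using mult_left_mono[OF ln_add_one_self_le_self[of "1 / real n"] assms(1)] by simp
  also have "\<dots> \<le> exp (- s * ln (1 + 1 / real n))"
    using exp_ge_add_one_self[of "- s * ln (1 + 1 / real n)"] by simp
  also have "\<dots> = (1 + 1 / real n) powr (-s)"
    using pos by (simp add: powr_def)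
  finally have "real n powr (-s) * (1 - s / real n) \<le> real n powr (-s) * (1 + 1 / real n) powr (-s)"
    by (intro mult_left_mono) auto
  also have "\<dots> = real (Suc n) powr (-s)"
    unfolding eq using assms by (simp add: powr_mult)
  finally show ?thesis .
qed

text \<open>
Chung's lemma. The claim \<open>y n \<le> K n powr (-s)\<close> propagates from \<open>n\<close> to \<open>n + 1\<close> because passing from
\<open>n\<close> to \<open>n + 1\<close> shrinks the bound by a factor of at least \<open>1 - s / n\<close>, while the recursion gains
\<open>(K - C) a n\<close>; the margin \<open>\<delta>\<close> lets a large \<open>K\<close> absorb the forcing constant \<open>C\<close>.
\<close>

lemma chung_recursion:
  fixes y a :: "nat \<Rightarrow> real" and s \<delta> C :: real
  assumes "s \<ge> 0" "\<delta> > 0" "C \<ge> 0"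
    and y_nonneg: "\<And>n. n \<ge> 1 \<Longrightarrow> y n \<ge> 0"
    and rec: "\<forall>\<^sub>F n in sequentially. y (Suc n) \<le> (1 - a n) * y n + C * a n * real n powr (-s)"
    and a_le: "\<forall>\<^sub>F n in sequentially. a n \<le> 1"
    and a_ge: "\<forall>\<^sub>F n in sequentially. (s + \<delta>) / real n \<le> a n"
  shows "y \<in> O(\<lambda>n. real n powr (-s))"
proof -
  have "\<forall>\<^sub>F n in sequentially. n \<ge> 1 \<and> a n \<le> 1 \<and> (s + \<delta>) / real n \<le> a n \<and>
      y (Suc n) \<le> (1 - a n) * y n + C * a n * real n powr (-s)"
    using rec a_le a_ge eventually_ge_at_top[of 1] by eventually_elim auto
  then obtain N where N: "\<And>n. n \<ge> N \<Longrightarrow> n \<ge> 1 \<and> a n \<le> 1 \<and> (s + \<delta>) / real n \<le> a n \<and>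
      y (Suc n) \<le> (1 - a n) * y n + C * a n * real n powr (-s)"
    unfolding eventually_sequentially by blast
  \<comment> \<open>The first bound is what the induction step needs, the second what its start needs.\<close>
  define K where "K = max (C * (s + \<delta>) / \<delta>) (y N * real N powr s)"
  have K: "C * (s + \<delta>) \<le> K * \<delta>"
    using \<open>\<delta> > 0\<close> unfolding K_def by (metis max.cobounded1 pos_divide_le_eq)
  have "K \<ge> 0"
    using assms(1-3) unfolding K_def by (simp add: le_max_iff_disj)
  have CK: "C \<le> K"
  proof -
    have "C * \<delta> \<le> C * (s + \<delta>)" using assms by (intro mult_left_mono) auto
    then show ?thesis using K \<open>\<delta> > 0\<close> by (metis mult_le_cancel_right_pos order_trans)
  qed
  have bound: "y n \<le> K * real n powr (-s)" if "n \<ge> N" for n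
    using that
  proof (induction n rule: dec_induct)
    case base
    have "y N = (y N * real N powr s) * real N powr (-s)"
      using N[of N] by (simp add: powr_minus)
    also have "\<dots> \<le> K * real N powr (-s)"
      unfolding K_def by (intro mult_right_mono) auto
    finally show ?case .
  next
    case (step n)
    have n: "n \<ge> 1" "a n \<le> 1" "(s + \<delta>) / real n \<le> a n"
      "y (Suc n) \<le> (1 - a n) * y n + C * a n * real n powr (-s)"
      using N[of n] step by auto
    have "K * (s / real n) \<le> (K - C) * ((s + \<delta>) / real n)"
      using K n(1) by (simp add: field_simps)
    also have "\<dots> \<le> (K - C) * a n"
      using CK n(3) by (intro mult_left_mono) auto
    finally have key: "K * (s / real n) \<le> (K - C) * a n" .
    have "y (Suc n) \<le> (1 - a n) * (K * real n powr (-s)) + C * a n * real n powr (-s)"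
      using n(4) mult_left_mono[OF step.IH, of "1 - a n"] n(2) by linarith
    also have "\<dots> = real n powr (-s) * (K - (K - C) * a n)"
      by (simp add: algebra_simps)
    also have "\<dots> \<le> real n powr (-s) * (K - K * (s / real n))"
      using key by (intro mult_left_mono) auto
    also have "\<dots> = K * (real n powr (-s) * (1 - s / real n))"
      by (simp add: algebra_simps)
    also have "\<dots> \<le> K * real (Suc n) powr (-s)"
      using powr_succ_lower_bound[OF assms(1) n(1)] \<open>K \<ge> 0\<close> by (intro mult_left_mono) auto
    finally show ?case .
  qed
  show ?thesis
  proof (rule bigoI[of _ K])
    show "\<forall>\<^sub>F n in sequentially. norm (y n) \<le> K * norm (real n powr (-s))"
      using eventually_ge_at_top[of N] by eventually_elim (use bound N y_nonneg in auto)
  qed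
qed

text \<open>
The bounds \<open>U \<le> K\<close> and \<open>V \<le> b K\<close> are invariant once the steps are small. Choosing \<open>b = a / (2 C)\<close>
makes the feedback \<open>C \<eta> V\<close> consume half of the contraction of \<open>U\<close>, leaving the other half for the
noise. No such choice is available in the equation for \<open>V\<close>; there the feedback is small because
\<open>\<eta> / p\<close> tends to \<open>0\<close>.
\<close>

lemma coupled_recursion_bounded:
  fixes U V \<eta> p :: "nat \<Rightarrow> real" and a C :: real
  assumes "a > 0" "C > 0"
    and U: "\<forall>\<^sub>F n in sequentially. U (Suc n) \<le> (1 - a * \<eta> n) * U n + C * \<eta> n * V n + C * (\<eta> n)\<^sup>2"
    and V: "\<forall>\<^sub>F n in sequentially.
      V (Suc n) \<le> (1 - p n / 2) * V n + C * p n * (\<eta> n / p n)\<^sup>2 * (1 + U n)"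
    and \<eta>: "\<forall>\<^sub>F n in sequentially. \<eta> n > 0" "\<eta> \<longlonglongrightarrow> 0"
    and p: "\<forall>\<^sub>F n in sequentially. 0 < p n \<and> p n \<le> 1"
    and ratio: "(\<lambda>n. \<eta> n / p n) \<longlonglongrightarrow> 0"
  shows "\<exists>K>0. \<forall>\<^sub>F n in sequentially. U n \<le> K \<and> V n \<le> K"
proof -
  define b where "b = a / (2 * C)"
  have b: "b > 0" "C * b = a / 2" using assms(1,2) by (auto simp: b_def)
  have lims: "(\<lambda>n. a * \<eta> n) \<longlonglongrightarrow> 0" "(\<lambda>n. C * \<eta> n) \<longlonglongrightarrow> 0" "(\<lambda>n. 4 * C * (\<eta> n / p n)\<^sup>2) \<longlonglongrightarrow> 0"
    using tendsto_mult_right_zero[OF \<eta>(2)] tendsto_mult_right_zero[OF tendsto_null_power[OF ratio]]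
    by auto
  have "\<forall>\<^sub>F n in sequentially. n \<ge> 1 \<and> \<eta> n > 0 \<and> 0 < p n \<and> p n \<le> 1
      \<and> a * \<eta> n < 1 \<and> C * \<eta> n < a / 2 \<and> 4 * C * (\<eta> n / p n)\<^sup>2 < b
      \<and> U (Suc n) \<le> (1 - a * \<eta> n) * U n + C * \<eta> n * V n + C * (\<eta> n)\<^sup>2
      \<and> V (Suc n) \<le> (1 - p n / 2) * V n + C * p n * (\<eta> n / p n)\<^sup>2 * (1 + U n)"
    using U V \<eta>(1) p order_tendstoD(2)[OF lims(1), of 1]
      order_tendstoD(2)[OF lims(2), of "a/2"] order_tendstoD(2)[OF lims(3), of b] assms(1) b(1)
    by (intro eventually_conj eventually_ge_at_top) (simp_all add: eventually_conj_iff)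
  then obtain N where N: "\<And>n. n \<ge> N \<Longrightarrow> n \<ge> 1 \<and> \<eta> n > 0 \<and> 0 < p n \<and> p n \<le> 1
      \<and> a * \<eta> n < 1 \<and> C * \<eta> n < a / 2 \<and> 4 * C * (\<eta> n / p n)\<^sup>2 < b
      \<and> U (Suc n) \<le> (1 - a * \<eta> n) * U n + C * \<eta> n * V n + C * (\<eta> n)\<^sup>2
      \<and> V (Suc n) \<le> (1 - p n / 2) * V n + C * p n * (\<eta> n / p n)\<^sup>2 * (1 + U n)"
    unfolding eventually_sequentially by blast
  \<comment> \<open>Taking \<open>K \<ge> 1\<close> allows the constant forcing terms to be bounded by multiples of \<open>K\<close>.\<close>
  define K where "K = max 1 (max (U N) (V N / b))"
  have K: "K \<ge> 1" "U N \<le> K" "V N \<le> b * K"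
  proof -
    show "K \<ge> 1" "U N \<le> K" by (auto simp: K_def)
    have "V N / b \<le> K" by (simp add: K_def)
    then show "V N \<le> b * K" using b(1) by (simp add: pos_divide_le_eq mult.commute)
  qed
  have bound: "U n \<le> K \<and> V n \<le> b * K" if "n \<ge> N" for n
    using that
  proof (induction n rule: dec_induct)
    case base
    then show ?case using K by simp
  next
    case (step n)
    have n: "n \<ge> 1" "\<eta> n > 0" "0 < p n" "p n \<le> 1" "a * \<eta> n < 1" "C * \<eta> n < a / 2"
      "4 * C * (\<eta> n / p n)\<^sup>2 < b"
      "U (Suc n) \<le> (1 - a * \<eta> n) * U n + C * \<eta> n * V n + C * (\<eta> n)\<^sup>2"
      "V (Suc n) \<le> (1 - p n / 2) * V n + C * p n * (\<eta> n / p n)\<^sup>2 * (1 + U n)"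
      using N[of n] step by auto
    have "(1 - a * \<eta> n) * U n \<le> (1 - a * \<eta> n) * K"
      using step.IH n(5) by (intro mult_left_mono) auto
    moreover have "C * \<eta> n * V n \<le> C * \<eta> n * (b * K)"
      using step.IH n(2) assms(2) by (intro mult_left_mono) auto
    moreover have "C * \<eta> n * (b * K) = a / 2 * \<eta> n * K"
      using b(2) by (metis mult.commute mult.left_commute)
    moreover have "C * (\<eta> n)\<^sup>2 \<le> a / 2 * \<eta> n * K"
    proof -
      have "C * (\<eta> n)\<^sup>2 = (C * \<eta> n) * \<eta> n" by (simp add: power2_eq_square)
      also have "\<dots> \<le> a / 2 * \<eta> n" using n by (intro mult_right_mono) auto
      also have "\<dots> \<le> a / 2 * \<eta> n * K" using n K assms(1) by simp
      finally show ?thesis .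
    qed
    moreover have "(1 - a * \<eta> n) * K + a / 2 * \<eta> n * K + a / 2 * \<eta> n * K = K"
      by (simp add: algebra_simps)
    ultimately have "U (Suc n) \<le> K"
      using n(8) by linarith
    moreover have "V (Suc n) \<le> b * K"
    proof -
      have "(1 - p n / 2) * V n \<le> (1 - p n / 2) * (b * K)"
        using step.IH n by (intro mult_left_mono) auto
      moreover have "C * p n * (\<eta> n / p n)\<^sup>2 * (1 + U n) \<le> C * p n * (\<eta> n / p n)\<^sup>2 * (2 * K)"
        using step.IH n K assms(2) by (intro mult_left_mono mult_nonneg_nonneg) auto
      moreover have "C * p n * (\<eta> n / p n)\<^sup>2 * (2 * K) = p n / 2 * K * (4 * C * (\<eta> n / p n)\<^sup>2)"
        by simp
      moreover have "\<dots> \<le> p n / 2 * K * b"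
        using n K by (intro mult_left_mono) auto
      ultimately show ?thesis using n(9) by (simp add: algebra_simps)
    qed
    ultimately show ?case ..
  qed
  show ?thesis
  proof (intro exI[of _ "max K (b * K)"] conjI)
    show "max K (b * K) > 0" using K by linarith
    show "\<forall>\<^sub>F n in sequentially. U n \<le> max K (b * K) \<and> V n \<le> max K (b * K)"
      using eventually_ge_at_top[of N] by eventually_elim (use bound in \<open>simp add: le_max_iff_disj\<close>)
  qed
qed

text \<open>
Truncating the coin probability at \<open>1\<close> costs only a constant factor, because the power
\<open>n powr (-\<alpha> \<beta>)\<close> never exceeds \<open>1\<close>.
\<close>

lemma min_power_step_lower_bound:
  fixes \<alpha> \<beta> \<gamma> \<eta>\<^sub>0 :: real
  assumes "0 \<le> \<alpha>" "0 \<le> \<beta>" "0 < \<eta>\<^sub>0" "n \<ge> 1"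
  shows "min (\<gamma> * \<eta>\<^sub>0 powr \<beta>) 1 * real n powr (- \<alpha> * \<beta>)
     \<le> min (\<gamma> * (\<eta>\<^sub>0 * real n powr (-\<alpha>)) powr \<beta>) 1"
proof (rule min.boundedI)
  have le1: "real n powr (- \<alpha> * \<beta>) \<le> 1"
    using assms powr_mono[of "- \<alpha> * \<beta>" 0 "real n"] by simp
  show "min (\<gamma> * \<eta>\<^sub>0 powr \<beta>) 1 * real n powr (- \<alpha> * \<beta>) \<le> 1"
    using le1 assms by (smt (verit) mult_le_one mult_left_le_one_le mult_nonneg_nonpos2 powr_ge_zero min.cobounded2)
  have "(\<eta>\<^sub>0 * real n powr (-\<alpha>)) powr \<beta> = \<eta>\<^sub>0 powr \<beta> * real n powr (- \<alpha> * \<beta>)"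
    using assms by (simp add: powr_mult powr_powr)
  then show "min (\<gamma> * \<eta>\<^sub>0 powr \<beta>) 1 * real n powr (- \<alpha> * \<beta>) \<le> \<gamma> * (\<eta>\<^sub>0 * real n powr (-\<alpha>)) powr \<beta>"
    by (simp add: mult.assoc[symmetric] mult_right_mono)
qed

lemma power_step_sizes:
  fixes \<eta> p :: "nat \<Rightarrow> real"
  assumes \<eta>: "\<And>n. n \<ge> 1 \<Longrightarrow> \<eta> n = \<eta>\<^sub>0 * real n powr (-\<alpha>)"
    and p: "\<And>n. n \<ge> 1 \<Longrightarrow> c * real n powr (- \<alpha> * \<beta>) \<le> p n"
    and c: "c > 0" and alpha: "0 < \<alpha>" and beta: "\<beta> < 1" and eta0: "\<eta>\<^sub>0 > 0"
  shows "\<And>n. n \<ge> 1 \<Longrightarrow> \<eta> n > 0" "\<And>n. n \<ge> 1 \<Longrightarrow> p n > 0"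
    and "\<And>n. n \<ge> 1 \<Longrightarrow> \<eta> n / p n \<le> \<eta>\<^sub>0 / c * real n powr (- \<alpha> * (1 - \<beta>))"
    and "\<eta> \<longlonglongrightarrow> 0" and "(\<lambda>n. \<eta> n / p n) \<longlonglongrightarrow> 0"
proof -
  have eta_pos: "\<eta> n > 0" if "n \<ge> 1" for n using that \<eta> eta0 by simp
  have p_pos: "p n > 0" if "n \<ge> 1" for n
  proof -
    have "0 < c * real n powr (- \<alpha> * \<beta>)" using that c by simp
    then show ?thesis using p[OF that] by linarith
  qed
  have ratio_le: "\<eta> n / p n \<le> \<eta>\<^sub>0 / c * real n powr (- \<alpha> * (1 - \<beta>))" if "n \<ge> 1" for n
  proof -
    have "\<eta> n / p n \<le> \<eta> n / (c * real n powr (- \<alpha> * \<beta>))"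
      using that c p p_pos eta_pos by (intro divide_left_mono) (auto intro: less_imp_le)
    also have "real n powr (- \<alpha>) = real n powr (- \<alpha> * (1 - \<beta>)) * real n powr (- \<alpha> * \<beta>)"
      by (simp add: powr_add[symmetric] algebra_simps)
    then have "\<eta> n / (c * real n powr (- \<alpha> * \<beta>)) = \<eta>\<^sub>0 / c * real n powr (- \<alpha> * (1 - \<beta>))"
      using that c by (simp add: \<eta>)
    finally show ?thesis .
  qed
  have eta_lim: "\<eta> \<longlonglongrightarrow> 0"
  proof (rule Lim_transform_eventually)
    show "(\<lambda>n. \<eta>\<^sub>0 * real n powr (-\<alpha>)) \<longlonglongrightarrow> 0"
      using alpha by (intro tendsto_mult_right_zero tendsto_neg_powr filterlim_real_sequentially) auto
    show "\<forall>\<^sub>F n in sequentially. \<eta>\<^sub>0 * real n powr - \<alpha> = \<eta> n"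
      using eventually_ge_at_top[of 1] by eventually_elim (simp add: \<eta>)
  qed
  have ratio_lim: "(\<lambda>n. \<eta> n / p n) \<longlonglongrightarrow> 0"
  proof (rule tendsto_sandwich)
    show "\<forall>\<^sub>F n in sequentially. 0 \<le> \<eta> n / p n"
      using eventually_ge_at_top[of 1]
      by eventually_elim (simp add: eta_pos p_pos less_imp_le)
    show "\<forall>\<^sub>F n in sequentially. \<eta> n / p n \<le> \<eta>\<^sub>0 / c * real n powr (- (\<alpha> * (1 - \<beta>)))"
      using eventually_ge_at_top[of 1] by eventually_elim (use ratio_le in simp)
    show "(\<lambda>n. \<eta>\<^sub>0 / c * real n powr (- (\<alpha> * (1 - \<beta>)))) \<longlonglongrightarrow> 0"
      using alpha beta by (intro tendsto_mult_right_zero tendsto_neg_powr filterlim_real_sequentially) auto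
  qed simp
  show "\<And>n. n \<ge> 1 \<Longrightarrow> \<eta> n > 0" "\<And>n. n \<ge> 1 \<Longrightarrow> p n > 0"
    "\<And>n. n \<ge> 1 \<Longrightarrow> \<eta> n / p n \<le> \<eta>\<^sub>0 / c * real n powr (- \<alpha> * (1 - \<beta>))"
    "\<eta> \<longlonglongrightarrow> 0" "(\<lambda>n. \<eta> n / p n) \<longlonglongrightarrow> 0"
    by fact+
qed

text \<open>
Boundedness of \<open>U\<close> turns the second recursion into a scalar one for \<open>V\<close>; the resulting rate of
\<open>V\<close> turns the first into a scalar one for \<open>U\<close>. Both are then instances of Chung's lemma. For \<open>V\<close>
the contraction \<open>p n / 2\<close> beats every multiple of \<open>1 / n\<close> because \<open>\<alpha> \<beta> < 1\<close>; for \<open>U\<close> the critical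
case is \<open>\<alpha> = 1\<close>, where \<open>a \<eta> n\<close> is itself a multiple of \<open>1 / n\<close>.
\<close>

lemma coupled_recursion_rates:
  fixes U V \<eta> p :: "nat \<Rightarrow> real" and a C :: real
  assumes a: "a > 0" and C: "C > 0"
    and nonneg: "\<And>n. n \<ge> 1 \<Longrightarrow> U n \<ge> 0" "\<And>n. n \<ge> 1 \<Longrightarrow> V n \<ge> 0"
    and U: "\<forall>\<^sub>F n in sequentially. U (Suc n) \<le> (1 - a * \<eta> n) * U n + C * \<eta> n * V n + C * (\<eta> n)\<^sup>2"
    and V: "\<forall>\<^sub>F n in sequentially.
      V (Suc n) \<le> (1 - p n / 2) * V n + C * p n * (\<eta> n / p n)\<^sup>2 * (1 + U n)"
    and \<eta>: "\<And>n. n \<ge> 1 \<Longrightarrow> \<eta> n = \<eta>\<^sub>0 * real n powr (-\<alpha>)"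
    and p: "\<And>n. n \<ge> 1 \<Longrightarrow> p n \<le> 1" "\<And>n. n \<ge> 1 \<Longrightarrow> c * real n powr (- \<alpha> * \<beta>) \<le> p n"
    and c: "c > 0" and alpha: "0 < \<alpha>" "\<alpha> \<le> 1" and beta: "0 \<le> \<beta>" "\<beta> < 1"
    and eta0: "\<eta>\<^sub>0 > 0" "\<alpha> = 1 \<Longrightarrow> a * \<eta>\<^sub>0 > 1"
  shows "U \<in> O(\<lambda>n. real n powr (-\<alpha> * min 1 (2 - 2 * \<beta>)))"
    and "V \<in> O(\<lambda>n. real n powr (-2 * \<alpha> * (1 - \<beta>)))"
proof -
  note steps = power_step_sizes[OF \<eta> p(2) c alpha(1) beta(2) eta0(1)]
  note eta_pos = steps(1) and p_pos = steps(2) and ratio_le = steps(3)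
    and eta_lim = steps(4) and ratio_lim = steps(5)
  have ev_pos: "\<forall>\<^sub>F n in sequentially. \<eta> n > 0" "\<forall>\<^sub>F n in sequentially. 0 < p n \<and> p n \<le> 1"
    using eventually_ge_at_top[of 1]
    by (eventually_elim, use eta_pos p_pos p in auto)+
  obtain K where K: "K > 0" "\<forall>\<^sub>F n in sequentially. U n \<le> K \<and> V n \<le> K"
    using coupled_recursion_bounded[OF a C U V ev_pos(1) eta_lim ev_pos(2) ratio_lim] by blast

  define t where "t = 2 * \<alpha> * (1 - \<beta>)"
  have t: "t \<ge> 0" using alpha beta by (simp add: t_def)
  have V_O: "V \<in> O(\<lambda>n. real n powr (-t))"
  proof (rule chung_recursion[OF t zero_less_one _ nonneg(2)])
    show "0 \<le> 2 * C * (\<eta>\<^sub>0 / c)\<^sup>2 * (1 + K)" using C K(1) by simp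
    show "\<forall>\<^sub>F n in sequentially. V (Suc n) \<le> (1 - p n / 2) * V n
        + 2 * C * (\<eta>\<^sub>0 / c)\<^sup>2 * (1 + K) * (p n / 2) * real n powr (-t)"
      using V K(2) eventually_ge_at_top[of 1]
    proof eventually_elim
      case (elim n)
      have "(\<eta> n / p n)\<^sup>2 \<le> (\<eta>\<^sub>0 / c * real n powr (- \<alpha> * (1 - \<beta>)))\<^sup>2"
        using elim ratio_le eta_pos p_pos by (intro power_mono) (auto intro: less_imp_le)
      also have "\<dots> = (\<eta>\<^sub>0 / c)\<^sup>2 * real n powr (-t)"
        by (simp add: power_mult_distrib t_def power2_eq_square powr_add[symmetric])
          (simp add: algebra_simps)
      finally have "C * p n * (\<eta> n / p n)\<^sup>2 * (1 + U n)
          \<le> C * p n * ((\<eta>\<^sub>0 / c)\<^sup>2 * real n powr (-t)) * (1 + K)"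
        using elim C p_pos[of n] nonneg(1)[of n]
        by (intro mult_mono mult_left_mono) auto
      then show ?case using elim by (simp add: mult_ac)
    qed
    show "\<forall>\<^sub>F n in sequentially. p n / 2 \<le> 1"
      using ev_pos(2) by eventually_elim auto
    show "\<forall>\<^sub>F n in sequentially. (t + 1) / real n \<le> p n / 2"
    proof -
      have "\<alpha> * \<beta> < 1" using alpha beta by (metis mult_le_one mult_left_le_one_le less_eq_real_def order_le_less_trans)
      then have "(\<lambda>n. 2 * (t + 1) * real n powr (- (1 - \<alpha> * \<beta>))) \<longlonglongrightarrow> 0"
        by (intro tendsto_mult_right_zero tendsto_neg_powr filterlim_real_sequentially) auto
      from order_tendstoD(2)[OF this c] show ?thesis
        using eventually_ge_at_top[of 1]
      proof eventually_elim
        case (elim n)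
        have "real n powr (- (1 - \<alpha> * \<beta>)) * real n powr (- \<alpha> * \<beta>) = 1 / real n"
          using elim unfolding powr_add[symmetric] by (simp add: powr_minus divide_inverse)
        then have "2 * ((t + 1) / real n) = 2 * (t + 1) * real n powr (- (1 - \<alpha> * \<beta>)) * real n powr (- \<alpha> * \<beta>)"
          by (simp only: mult.assoc) simp
        also have "\<dots> \<le> c * real n powr (- \<alpha> * \<beta>)" using elim by (intro mult_right_mono) auto
        also have "\<dots> \<le> p n" using p(2) elim by simp
        finally show ?case by linarith
      qed
    qed
  qed
  then show "V \<in> O(\<lambda>n. real n powr (-2 * \<alpha> * (1 - \<beta>)))"
    by (simp add: t_def)

  define s where "s = \<alpha> * min 1 (2 - 2 * \<beta>)"
  have s: "s \<ge> 0" "s \<le> t" "s \<le> \<alpha>"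
    using alpha beta by (auto simp: s_def t_def min_def algebra_simps)
  obtain B where B: "B > 0" "\<forall>\<^sub>F n in sequentially. V n \<le> B * real n powr (-t)"
  proof -
    obtain B where "B > 0" and B: "\<forall>\<^sub>F n in sequentially. norm (V n) \<le> B * norm (real n powr (-t))"
      using V_O by (rule landau_o.bigE)
    from B have "\<forall>\<^sub>F n in sequentially. V n \<le> B * real n powr (-t)"
      by eventually_elim simp
    with \<open>B > 0\<close> that show ?thesis by blast
  qed
  obtain \<delta> where \<delta>: "\<delta> > 0" "\<forall>\<^sub>F n in sequentially. (s + \<delta>) / real n \<le> a * \<eta> n"
  proof (cases "\<alpha> = 1")
    case True
    have "\<forall>\<^sub>F n in sequentially. (s + (a * \<eta>\<^sub>0 - s)) / real n \<le> a * \<eta> n"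
      using eventually_ge_at_top[of 1]
      by eventually_elim (simp add: \<eta> True powr_minus divide_inverse)
    moreover have "a * \<eta>\<^sub>0 - s > 0" using eta0(2) True s by auto
    ultimately show ?thesis using that by blast
  next
    case False
    have "(\<lambda>n. (s + 1) * real n powr (- (1 - \<alpha>))) \<longlonglongrightarrow> 0"
      using False alpha by (intro tendsto_mult_right_zero tendsto_neg_powr filterlim_real_sequentially) auto
    then have "\<forall>\<^sub>F n in sequentially. (s + 1) * real n powr (- (1 - \<alpha>)) < a * \<eta>\<^sub>0"
      using order_tendstoD(2) a eta0(1) by fastforce
    then have "\<forall>\<^sub>F n in sequentially. (s + 1) / real n \<le> a * \<eta> n"
      using eventually_ge_at_top[of 1]
    proof eventually_elim
      case (elim n)
      have "real n powr (- (1 - \<alpha>)) * real n powr (- \<alpha>) = 1 / real n"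
        using elim unfolding powr_add[symmetric] by (simp add: powr_minus divide_inverse)
      then have "(s + 1) / real n = (s + 1) * real n powr (- (1 - \<alpha>)) * real n powr (- \<alpha>)"
        by (simp only: mult.assoc) simp
      also have "\<dots> \<le> a * \<eta>\<^sub>0 * real n powr (- \<alpha>)"
        using elim by (intro mult_right_mono) auto
      finally show ?case using \<eta> elim by simp
    qed
    with that show ?thesis using zero_less_one by blast
  qed
  have "U \<in> O(\<lambda>n. real n powr (-s))"
  proof (rule chung_recursion[OF s(1) \<delta>(1) _ nonneg(1)])
    show "0 \<le> (C * B + C * \<eta>\<^sub>0) / a" using a C B eta0 by simp
    show "\<forall>\<^sub>F n in sequentially. U (Suc n) \<le> (1 - a * \<eta> n) * U n
        + (C * B + C * \<eta>\<^sub>0) / a * (a * \<eta> n) * real n powr (-s)"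
      using U B(2) eventually_ge_at_top[of 1]
    proof eventually_elim
      case (elim n)
      have "V n \<le> B * real n powr (-t)" using elim by simp
      also have "\<dots> \<le> B * real n powr (-s)"
        using B(1) s elim by (intro mult_left_mono powr_mono) auto
      finally have "C * \<eta> n * V n \<le> C * \<eta> n * (B * real n powr (-s))"
        using C elim eta_pos[of n] by (intro mult_left_mono) auto
      moreover have "\<eta> n \<le> \<eta>\<^sub>0 * real n powr (-s)"
        using \<eta>[of n] elim s eta0 by (auto intro!: mult_left_mono powr_mono)
      then have "C * \<eta> n * \<eta> n \<le> C * \<eta> n * (\<eta>\<^sub>0 * real n powr (-s))"
        using C elim eta_pos[of n] by (intro mult_left_mono) auto
      moreover have "(C * B + C * \<eta>\<^sub>0) / a * (a * \<eta> n) * real n powr (-s)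
          = C * \<eta> n * (B * real n powr (-s)) + C * \<eta> n * (\<eta>\<^sub>0 * real n powr (-s))"
        using a by (simp add: field_simps)
      ultimately show ?case
        using elim by (simp add: power2_eq_square mult.assoc)
    qed
    show "\<forall>\<^sub>F n in sequentially. a * \<eta> n \<le> 1"
      using order_tendstoD(2)[OF tendsto_mult_right_zero[OF eta_lim, of a], of 1]
      by (auto elim: eventually_mono)
    show "\<forall>\<^sub>F n in sequentially. (s + \<delta>) / real n \<le> a * \<eta> n" by fact
  qed
  then show "U \<in> O(\<lambda>n. real n powr (-\<alpha> * min 1 (2 - 2 * \<beta>)))"
    by (simp add: s_def)
qed

section \<open>Orthogonal splitting along the constraint subspace\<close>

lemma proj_col_in_span: "proj_col A x \<in> span (columns A)"
  unfolding proj_col_def by (intro orth_proj_in subspace_span)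

lemma proj_col_residual: "s \<in> span (columns A) \<Longrightarrow> (x - proj_col A x) \<bullet> s = 0"
  using orth_proj_orthogonal[OF subspace_span] unfolding proj_col_def orthogonal_def by blast

lemma proj_col_eqI:
  assumes "y \<in> span (columns A)" "\<And>s. s \<in> span (columns A) \<Longrightarrow> (x - y) \<bullet> s = 0"
  shows "proj_col A x = y"
  unfolding proj_col_def using assms by (intro orth_proj_eqI subspace_span) (auto simp: orthogonal_def)

lemma linear_proj_col: "linear (proj_col A)"
proof (rule linearI)
  show "proj_col A (x + y) = proj_col A x + proj_col A y" for x y
  proof (rule proj_col_eqI)
    show "proj_col A x + proj_col A y \<in> span (columns A)"
      by (intro span_add proj_col_in_span)
    show "(x + y - (proj_col A x + proj_col A y)) \<bullet> s = 0" if "s \<in> span (columns A)" for s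
      using proj_col_residual[OF that, of x] proj_col_residual[OF that, of y]
      by (simp add: inner_diff_left inner_add_left)
  qed
  show "proj_col A (c *\<^sub>R x) = c *\<^sub>R proj_col A x" for c x
  proof (rule proj_col_eqI)
    show "c *\<^sub>R proj_col A x \<in> span (columns A)"
      by (intro span_scale proj_col_in_span)
    show "(c *\<^sub>R x - c *\<^sub>R proj_col A x) \<bullet> s = 0" if "s \<in> span (columns A)" for s
      using proj_col_residual[OF that, of x] by (simp add: inner_diff_left)
  qed
qed

lemma linear_proj_perp: "linear (proj_perp A)"
  unfolding proj_perp_def by (intro linear_compose_sub linear_proj_col linear_id[unfolded id_def])

lemma proj_perp_in_null: "transpose A *v proj_perp A x = 0"
  unfolding transpose_null_iff proj_perp_def proj_col_def by (simp add: orth_proj_orthogonal)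

lemma null_inner_proj_col: "transpose A *v h = 0 \<Longrightarrow> h \<bullet> proj_col A x = 0"
  using proj_col_in_span unfolding transpose_null_iff orthogonal_def by blast

lemma proj_perp_inner_proj_col: "proj_perp A y \<bullet> proj_col A x = 0"
  by (intro null_inner_proj_col proj_perp_in_null)

lemma proj_split: "x = proj_perp A x + proj_col A x"
  by (simp add: proj_perp_def)

lemma proj_col_null: "transpose A *v h = 0 \<Longrightarrow> proj_col A h = 0"
  unfolding transpose_null_iff proj_col_def
  by (intro orth_proj_eqI) (auto simp: span_zero)

lemma proj_perp_null: "transpose A *v h = 0 \<Longrightarrow> proj_perp A h = h"
  by (simp add: proj_perp_def proj_col_null)

lemma proj_col_proj_perp: "proj_col A (proj_perp A x) = 0"
  by (intro proj_col_null proj_perp_in_null)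

lemma proj_perp_proj_perp: "proj_perp A (proj_perp A x) = proj_perp A x"
  by (intro proj_perp_null proj_perp_in_null)

lemma inner_proj_perp:
  assumes "transpose A *v h = 0" shows "h \<bullet> proj_perp A x = h \<bullet> x"
  using null_inner_proj_col[OF assms, of x] by (simp add: proj_perp_def inner_diff_right)

lemma inner_proj_col: "proj_col A y \<bullet> proj_col A x = proj_col A y \<bullet> x"
  by (subst (2) proj_split[of x A])
    (simp add: inner_add_right inner_commute[of "proj_col A y" "proj_perp A x"] proj_perp_inner_proj_col)

lemma pythagoras_proj: "(norm x)\<^sup>2 = (norm (proj_perp A x))\<^sup>2 + (norm (proj_col A x))\<^sup>2"
  by (subst (1) proj_split[of x A], subst norm_add_Pythagorean)
    (simp_all add: orthogonal_def proj_perp_inner_proj_col)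

lemma norm_proj_le:
  shows norm_proj_perp_le: "norm (proj_perp A x) \<le> norm x"
    and norm_proj_col_le: "norm (proj_col A x) \<le> norm x"
  by (rule power2_le_imp_le; simp add: pythagoras_proj[of x A])+

text \<open>
First-order optimality: restricted to the line through \<open>xs\<close> in a feasible direction \<open>h\<close>, the
function has a minimum at \<open>xs\<close>.
\<close>

lemma grad_orthogonal_at_constrained_min:
  fixes A :: "real^'m^'d"
  assumes min: "is_arg_min f (\<lambda>y. transpose A *v y = 0) xs"
    and diff: "f differentiable (at xs)" and h: "transpose A *v h = 0"
  shows "h \<bullet> grad f xs = 0"
proof -
  have xs: "transpose A *v xs = 0" "\<And>y. transpose A *v y = 0 \<Longrightarrow> f xs \<le> f y"
    using min by (auto simp: is_arg_min_def not_less)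
  have "(f has_derivative (\<lambda>k. k \<bullet> grad f xs)) (at xs)"
    using GDERIV_grad[OF diff] by (simp add: gderiv_def)
  then have "((\<lambda>t::real. f (xs + t *\<^sub>R h)) has_derivative (\<lambda>t. (t *\<^sub>R h) \<bullet> grad f xs)) (at 0)"
    by (intro has_derivative_compose[of "\<lambda>t. xs + t *\<^sub>R h" "\<lambda>t. t *\<^sub>R h" 0 UNIV f]) (auto intro!: derivative_eq_intros)
  then have "((\<lambda>t::real. f (xs + t *\<^sub>R h)) has_field_derivative (h \<bullet> grad f xs)) (at 0)"
    by (simp add: has_field_derivative_def mult.commute[of _ "h \<bullet> grad f xs"] cong: if_cong)
  then show ?thesis
    by (rule DERIV_local_min[where d=1])
      (auto intro!: xs(2) simp del: transpose_matrix_vector simp: matrix_vector_right_distrib matrix_vector_mult_scaleR xs(1) h)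
qed

lemma strong_monotonicity:
  fixes f :: "'a::real_inner \<Rightarrow> real"
  assumes "\<And>y z. f y - f z \<ge> grad f z \<bullet> (y - z) + \<mu> / 2 * (norm (y - z))\<^sup>2"
  shows "\<mu> * (norm (y - z))\<^sup>2 \<le> (y - z) \<bullet> (grad f y - grad f z)"
  using assms[of z y] assms[of y z]
  by (simp add: inner_commute norm_minus_commute algebra_simps)

lemma young_inequality:
  fixes a b :: real
  assumes "c > 0" shows "a * b \<le> c * a\<^sup>2 + b\<^sup>2 / (4 * c)"
proof -
  have "0 \<le> (2 * c * a - b)\<^sup>2 / (4 * c)" using assms by simp
  also have "\<dots> = c * a\<^sup>2 + b\<^sup>2 / (4 * c) - a * b"
    using assms by (simp add: power2_eq_square field_simps)
  finally show ?thesis by simp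
qed

text \<open>
Evaluating the gradient at the feasible point \<open>proj_perp A y\<close> instead of at \<open>y\<close> costs at most
\<open>L \<parallel>proj_col A y\<parallel>\<close>; there, strong monotonicity and first-order optimality apply. A quarter of
the contraction \<open>\<mu>\<close> pays for the cross term, and the remaining excess over \<open>\<mu> / 2\<close> is later spent
on the noise.
\<close>

lemma perp_descent:
  fixes A :: "real^'m^'d" and f :: "real^'d \<Rightarrow> real"
  assumes min: "is_arg_min f (\<lambda>y. transpose A *v y = 0) xs"
    and diff: "f differentiable (at xs)"
    and smooth: "\<And>y z. norm (grad f y - grad f z) \<le> L * norm (y - z)"
    and mu: "\<mu> > 0"
    and sc: "\<And>y z. f y - f z \<ge> grad f z \<bullet> (y - z) + \<mu> / 2 * (norm (y - z))\<^sup>2"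
  shows "3 / 4 * \<mu> * (norm (proj_perp A y - xs))\<^sup>2 - L\<^sup>2 / \<mu> * (norm (proj_col A y))\<^sup>2
    \<le> (proj_perp A y - xs) \<bullet> grad f y"
proof -
  let ?u = "proj_perp A y" and ?v = "proj_col A y"
  have xs: "transpose A *v xs = 0" using min by (simp add: is_arg_min_def)
  have null: "transpose A *v (?u - xs) = 0"
    using xs proj_perp_in_null[of A y] by (simp del: transpose_matrix_vector add: matrix_vector_mult_diff_distrib)
  have "(?u - xs) \<bullet> (grad f y - grad f ?u) \<ge> - (norm (?u - xs) * (L * norm ?v))"
  proof -
    have "\<bar>(?u - xs) \<bullet> (grad f y - grad f ?u)\<bar> \<le> norm (?u - xs) * norm (grad f y - grad f ?u)"
      by (rule Cauchy_Schwarz_ineq2)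
    also have "\<dots> \<le> norm (?u - xs) * (L * norm ?v)"
      using smooth[of y ?u] by (intro mult_left_mono) (auto simp: proj_perp_def)
    finally show ?thesis by linarith
  qed
  moreover have "(?u - xs) \<bullet> (grad f ?u - grad f xs) \<ge> \<mu> * (norm (?u - xs))\<^sup>2"
    by (rule strong_monotonicity[OF sc])
  moreover have "(?u - xs) \<bullet> grad f xs = 0"
    by (rule grad_orthogonal_at_constrained_min[OF min diff null])
  moreover have "norm (?u - xs) * (L * norm ?v) \<le> \<mu> / 4 * (norm (?u - xs))\<^sup>2 + L\<^sup>2 / \<mu> * (norm ?v)\<^sup>2"
    using young_inequality[of "\<mu>/4" "norm (?u - xs)" "L * norm ?v"] mu by (simp add: power_mult_distrib)
  ultimately show ?thesis by (simp add: inner_diff_right)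
qed

text \<open>
The drift of the column component is first order in its norm, since \<open>grad f xs\<close> need not vanish.
Splitting each product with weight \<open>p / 8\<close> keeps the quadratic part below the contraction of
relative size \<open>p\<close> due to the coin, at the price of the factor \<open>\<eta>\<^sup>2 / p\<close>; this is the origin of the
rate \<open>(\<eta> / p)\<^sup>2\<close>.
\<close>

lemma col_drift:
  fixes A :: "real^'m^'d" and f :: "real^'d \<Rightarrow> real"
  assumes smooth: "\<And>y z. norm (grad f y - grad f z) \<le> L * norm (y - z)"
    and L: "L \<ge> 0" and p: "p > 0" and eta: "\<eta> \<ge> 0"
  shows "- 2 * \<eta> * (proj_col A y \<bullet> grad f y) \<le> (p / 4 + 2 * L * \<eta>) * (norm (proj_col A y))\<^sup>2
     + 8 * \<eta>\<^sup>2 / p * ((norm (grad f xs))\<^sup>2 + L\<^sup>2 * (norm (proj_perp A y - xs))\<^sup>2)"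
proof -
  let ?e = "norm (proj_perp A y - xs)" and ?v = "norm (proj_col A y)" and ?g = "norm (grad f xs)"
  have "norm (y - xs) \<le> ?e + ?v"
    using norm_triangle_ineq[of "proj_perp A y - xs" "proj_col A y"] by (simp add: proj_perp_def)
  then have "norm (grad f y) \<le> ?g + L * (?e + ?v)"
    using smooth[of y xs] norm_triangle_sub[of "grad f y" "grad f xs"] mult_left_mono[OF _ L]
    by (smt (verit))
  then have "?v * norm (grad f y) \<le> ?v * (?g + L * (?e + ?v))"
    by (intro mult_left_mono) auto
  moreover have "- (proj_col A y \<bullet> grad f y) \<le> ?v * norm (grad f y)"
    using Cauchy_Schwarz_ineq2[of "proj_col A y" "grad f y"] by linarith
  ultimately have "- (proj_col A y \<bullet> grad f y) \<le> ?v * (?g + L * (?e + ?v))" by linarith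
  then have "2 * \<eta> * - (proj_col A y \<bullet> grad f y) \<le> 2 * \<eta> * (?v * (?g + L * (?e + ?v)))"
    using eta by (intro mult_left_mono) auto
  also have "\<dots> = ?v * (2 * \<eta> * ?g) + ?v * (2 * \<eta> * L * ?e) + 2 * L * \<eta> * ?v\<^sup>2"
    by (simp add: algebra_simps power2_eq_square)
  also have "?v * (2 * \<eta> * ?g) \<le> p / 8 * ?v\<^sup>2 + 8 * \<eta>\<^sup>2 / p * ?g\<^sup>2"
    using young_inequality[of "p/8" ?v "2 * \<eta> * ?g"] p by (simp add: power_mult_distrib field_simps)
  also have "?v * (2 * \<eta> * L * ?e) \<le> p / 8 * ?v\<^sup>2 + 8 * \<eta>\<^sup>2 / p * (L\<^sup>2 * ?e\<^sup>2)"
    using young_inequality[of "p/8" ?v "2 * \<eta> * L * ?e"] p by (simp add: power_mult_distrib field_simps)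
  finally show ?thesis by (simp add: algebra_simps)
qed

section \<open>Measurability and second moments of random gradients\<close>

text \<open>
A function that is continuous in one variable and measurable in the other is the pointwise limit of
the functions obtained by rounding the continuous variable to finitely many values.
\<close>

lemma borel_measurable_caratheodory:
  fixes F :: "'a::{second_countable_topology, metric_space} \<Rightarrow> 'z \<Rightarrow> 'b::metric_space"
  assumes meas: "\<And>y. F y \<in> borel_measurable D"
    and cont: "\<And>z y. z \<in> space D \<Longrightarrow> isCont (\<lambda>y. F y z) y"
  shows "(\<lambda>(y, z). F y z) \<in> borel_measurable (borel \<Otimes>\<^sub>M D)"
proof -
  obtain q :: "nat \<Rightarrow> 'a \<Rightarrow> 'a"
    where q_simple: "\<forall>i. simple_function borel (q i)" and q_lim: "\<forall>y\<in>space borel. (\<lambda>i. q i y) \<longlonglongrightarrow> y"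
    using borel_measurable_implies_sequence_metric[OF measurable_ident_sets[OF refl, of "borel :: 'a measure"]]
    by blast
  have "(\<lambda>x. F (q i (fst x)) (snd x)) \<in> borel_measurable (borel \<Otimes>\<^sub>M D)" for i
  proof (rule measurable_compose_countable'[where I = "range (q i)"])
    show "(\<lambda>x. F y (snd x)) \<in> borel_measurable (borel \<Otimes>\<^sub>M D)" for y
      using meas by measurable
    have "q i \<in> measurable borel (count_space UNIV)"
      using q_simple by (blast intro: measurable_simple_function)
    from measurable_sets[OF this] have "q i \<in> measurable borel (count_space (range (q i)))"
      by (intro measurableI) auto
    then show "(\<lambda>x. q i (fst x)) \<in> measurable (borel \<Otimes>\<^sub>M D) (count_space (range (q i)))"
      by measurable
    show "countable (range (q i))"
      using simple_functionD(1)[OF q_simple[rule_format], of i] by (simp add: countable_finite)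
  qed
  then have "(\<lambda>x. F (fst x) (snd x)) \<in> borel_measurable (borel \<Otimes>\<^sub>M D)"
  proof (rule borel_measurable_LIMSEQ_metric)
    fix x :: "'a \<times> 'z" assume "x \<in> space (borel \<Otimes>\<^sub>M D)"
    then have "isCont (\<lambda>y. F y (snd x)) (fst x)"
      by (intro cont) (auto simp: space_pair_measure)
    then show "(\<lambda>i. F (q i (fst x)) (snd x)) \<longlonglongrightarrow> F (fst x) (snd x)"
      by (rule isCont_tendsto_compose) (use q_lim in simp)
  qed
  then show ?thesis by (simp add: case_prod_beta')
qed

lemma grad_inner_as_limit:
  fixes h :: "'a::euclidean_space \<Rightarrow> real"
  assumes "h differentiable (at y)"
  shows "(\<lambda>i. real (Suc i) * (h (y + inverse (real (Suc i)) *\<^sub>R b) - h y)) \<longlonglongrightarrow> grad h y \<bullet> b"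
proof -
  have "(h has_derivative (\<lambda>k. k \<bullet> grad h y)) (at (y + 0 *\<^sub>R b))"
    using GDERIV_grad[OF assms] by (simp add: gderiv_def)
  moreover have "((\<lambda>t::real. y + t *\<^sub>R b) has_derivative (\<lambda>t. t *\<^sub>R b)) (at 0)"
    by (auto intro!: derivative_eq_intros)
  ultimately have "((\<lambda>t::real. h (y + t *\<^sub>R b)) has_derivative (\<lambda>t. (t *\<^sub>R b) \<bullet> grad h y)) (at 0)"
    by (rule has_derivative_compose[rotated])
  then have "((\<lambda>t::real. h (y + t *\<^sub>R b)) has_field_derivative (grad h y \<bullet> b)) (at 0)"
    by (rule has_derivative_imp_has_field_derivative) (simp add: inner_commute)
  then have *: "((\<lambda>t. (h (y + t *\<^sub>R b) - h y) / t) \<longlongrightarrow> grad h y \<bullet> b) (at 0)"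
    by (simp add: has_field_derivative_iff)
  have "filterlim (\<lambda>i. inverse (real (Suc i))) (at 0) sequentially"
    by (intro filterlim_atI LIMSEQ_inverse_real_of_nat) auto
  from filterlim_compose[OF * this] show ?thesis
    by (simp add: divide_inverse mult.commute)
qed

text \<open>
Evaluating a random gradient at a random point needs joint measurability; each component is a
limit of difference quotients, which are jointly measurable by the Caratheodory property.
\<close>

lemma borel_measurable_grad:
  fixes F :: "'a::euclidean_space \<Rightarrow> 'z \<Rightarrow> real"
  assumes meas: "\<And>y. F y \<in> borel_measurable D"
    and diff: "\<And>y z. z \<in> space D \<Longrightarrow> (\<lambda>y. F y z) differentiable (at y)"
  shows "(\<lambda>(y, z). grad (\<lambda>y. F y z) y) \<in> borel_measurable (borel \<Otimes>\<^sub>M D)"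
proof -
  have F: "(\<lambda>(y, z). F y z) \<in> borel_measurable (borel \<Otimes>\<^sub>M D)"
    using meas diff by (intro borel_measurable_caratheodory differentiable_imp_continuous_within) auto
  have F_comp: "(\<lambda>x. F (g x) (snd x)) \<in> borel_measurable (borel \<Otimes>\<^sub>M D)"
    if [measurable]: "g \<in> borel_measurable (borel \<Otimes>\<^sub>M D)" for g
  proof -
    have "(\<lambda>x. (g x, snd x)) \<in> measurable (borel \<Otimes>\<^sub>M D) (borel \<Otimes>\<^sub>M D)" by measurable
    from measurable_compose[OF this F] show ?thesis by simp
  qed
  have "(\<lambda>x. grad (\<lambda>y. F y (snd x)) (fst x) \<bullet> b) \<in> borel_measurable (borel \<Otimes>\<^sub>M D)" for b
  proof (rule borel_measurable_LIMSEQ_metric)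
    show "(\<lambda>x. real (Suc i) * (F (fst x + inverse (real (Suc i)) *\<^sub>R b) (snd x) - F (fst x) (snd x)))
        \<in> borel_measurable (borel \<Otimes>\<^sub>M D)" for i
      by (intro borel_measurable_times borel_measurable_diff F_comp) measurable
    show "(\<lambda>i. real (Suc i) * (F (fst x + inverse (real (Suc i)) *\<^sub>R b) (snd x) - F (fst x) (snd x)))
        \<longlonglongrightarrow> grad (\<lambda>y. F y (snd x)) (fst x) \<bullet> b" if "x \<in> space (borel \<Otimes>\<^sub>M D)" for x
      using that by (intro grad_inner_as_limit diff) (auto simp: space_pair_measure)
  qed
  then have "(\<lambda>x. grad (\<lambda>y. F y (snd x)) (fst x)) \<in> borel_measurable (borel \<Otimes>\<^sub>M D)"
    by (subst borel_measurable_euclidean_space) blast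
  then show ?thesis by (simp add: case_prod_beta')
qed

lemma matrix_component_le_onorm:
  fixes B :: "real^'n^'m"
  shows "\<bar>B $ i $ j\<bar> \<le> onorm ((*v) B)"
proof -
  have "\<bar>B $ i $ j\<bar> = \<bar>(B *v axis j 1) $ i\<bar>"
    by (simp add: matrix_vector_mult_basis column_def)
  also have "\<dots> \<le> norm (B *v axis j 1)" by (rule component_le_norm_cart)
  also have "\<dots> \<le> onorm ((*v) B) * norm (axis j 1 :: real^'n)"
    by (intro onorm matrix_vector_mul_bounded_linear)
  finally show ?thesis by simp
qed

text \<open>
Bias-variance decomposition summed over the coordinates: the diagonal of the covariance matrix
consists of the variances.
\<close>

lemma (in prob_space) second_moment_eq_trace:
  fixes g :: "'a \<Rightarrow> real^'d"
  assumes int: "integrable M g" and sq: "integrable M (\<lambda>z. (norm (g z))\<^sup>2)"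
  shows "(\<integral>z. (norm (g z))\<^sup>2 \<partial>M) = (norm (\<integral>z. g z \<partial>M))\<^sup>2 + (\<Sum>i\<in>UNIV. cov_matrix M g $ i $ i)"
proof -
  have norm_sq: "(norm v)\<^sup>2 = (\<Sum>i\<in>UNIV. (v $ i)\<^sup>2)" for v :: "real^'d"
    by (simp add: norm_vec_def L2_set_def sum_nonneg)
  have comp: "integrable M (\<lambda>z. g z $ i)" "(\<integral>z. g z $ i \<partial>M) = (\<integral>z. g z \<partial>M) $ i" for i
    using int integrable_bounded_linear[OF bounded_linear_vec_nth int, of i]
      integral_bounded_linear[OF bounded_linear_vec_nth int, of i] by auto
  have [measurable]: "(\<lambda>z. g z $ i) \<in> borel_measurable M" for i using comp(1) by blast
  have comp_sq: "integrable M (\<lambda>z. (g z $ i)\<^sup>2)" for i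
  proof (rule Bochner_Integration.integrable_bound[OF sq])
    show "AE z in M. norm ((g z $ i)\<^sup>2) \<le> norm ((norm (g z))\<^sup>2)"
      using component_le_norm_cart[of _ i] by (auto simp: abs_le_square_iff[symmetric])
  qed measurable
  have "cov_matrix M g $ i $ i = (\<integral>z. (g z $ i)\<^sup>2 \<partial>M) - ((\<integral>z. g z \<partial>M) $ i)\<^sup>2" for i
    using variance_eq[OF comp(1)[of i] comp_sq[of i]] comp(2)[of i]
    by (simp add: cov_matrix_def power2_eq_square)
  then have "(\<Sum>i\<in>UNIV. cov_matrix M g $ i $ i)
      = (\<Sum>i\<in>UNIV. \<integral>z. (g z $ i)\<^sup>2 \<partial>M) - (norm (\<integral>z. g z \<partial>M))\<^sup>2"
    by (simp add: sum_subtractf norm_sq)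
  moreover have "(\<integral>z. (norm (g z))\<^sup>2 \<partial>M) = (\<Sum>i\<in>UNIV. \<integral>z. (g z $ i)\<^sup>2 \<partial>M)"
    unfolding norm_sq by (rule Bochner_Integration.integral_sum) (rule comp_sq)
  ultimately show ?thesis by simp
qed

lemma integrable_inner_of_squares:
  fixes a b :: "'w \<Rightarrow> 'v::euclidean_space"
  assumes [measurable]: "a \<in> borel_measurable M" "b \<in> borel_measurable M"
    and "integrable M (\<lambda>w. (norm (a w))\<^sup>2)" "integrable M (\<lambda>w. (norm (b w))\<^sup>2)"
  shows "integrable M (\<lambda>w. a w \<bullet> b w)"
proof (rule Bochner_Integration.integrable_bound)
  show "integrable M (\<lambda>w. (norm (a w))\<^sup>2 + (norm (b w))\<^sup>2)" using assms by simp
  show "AE w in M. norm (a w \<bullet> b w) \<le> norm ((norm (a w))\<^sup>2 + (norm (b w))\<^sup>2)"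
  proof (rule AE_I2)
    fix w
    have "\<bar>a w \<bullet> b w\<bar> \<le> norm (a w) * norm (b w)" by (rule Cauchy_Schwarz_ineq2)
    also have "2 * \<dots> \<le> (norm (a w))\<^sup>2 + (norm (b w))\<^sup>2"
      using sum_squares_bound by (simp add: mult.assoc)
    finally show "norm (a w \<bullet> b w) \<le> norm ((norm (a w))\<^sup>2 + (norm (b w))\<^sup>2)" by simp
  qed
qed measurable

context lpsa
begin

definition sgrad where
  "sgrad y z = grad (\<lambda>y. F y z) y"

lemma sgrad_measurable: "(\<lambda>(y, z). sgrad y z) \<in> borel_measurable (borel \<Otimes>\<^sub>M D)"
  unfolding sgrad_def using F_integrable F_differentiable by (intro borel_measurable_grad) auto

lemma sgrad_compose_measurable [measurable (raw)]:
  assumes "X \<in> borel_measurable N" "Z \<in> measurable N D"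
  shows "(\<lambda>w. sgrad (X w) (Z w)) \<in> borel_measurable N"
  using measurable_compose[OF measurable_Pair[OF assms] sgrad_measurable] by simp

lemma integral_sgrad: "(\<integral>z. sgrad y z \<partial>D) = grad f y"
  unfolding sgrad_def by (rule grad_unbiased)

lemma sgrad_integrable: "integrable D (sgrad y)" "integrable D (\<lambda>z. (norm (sgrad y z))\<^sup>2)"
  unfolding sgrad_def using grad_integrable grad_square_integrable by auto

text \<open>
By the trace formula it suffices to bound the squared gradient of \<open>f\<close> and the trace of the
covariance. The former grows quadratically by smoothness, and the latter at most linearly,
because the covariance is Lipschitz in operator norm, which dominates each diagonal entry.
\<close>

lemma second_moment_growth:
  assumes smooth: "\<And>y z. norm (grad f y - grad f z) \<le> L * norm (y - z)"
    and lip: "\<And>y z. onorm ((*v) (cov_matrix D (sgrad y) - cov_matrix D (sgrad z))) \<le> L * norm (y - z)"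
    and L: "L \<ge> 0"
  shows "\<exists>B\<ge>0. \<forall>y. (\<integral>z. (norm (sgrad y z))\<^sup>2 \<partial>D) \<le> B * (1 + (norm (y - xs))\<^sup>2)"
proof -
  let ?d = "real CARD('d)" and ?g = "norm (grad f xs)"
  let ?T = "\<lambda>y. \<Sum>i\<in>UNIV. cov_matrix D (sgrad y) $ i $ i"
  define B where "B = 2 * ?g\<^sup>2 + 2 * L\<^sup>2 + \<bar>?T xs\<bar> + ?d * L"
  have "(\<integral>z. (norm (sgrad y z))\<^sup>2 \<partial>D) \<le> B * (1 + (norm (y - xs))\<^sup>2)" for y
  proof -
    let ?r = "norm (y - xs)"
    have "norm (grad f y) \<le> ?g + L * ?r"
      using smooth[of y xs] norm_triangle_sub[of "grad f y" "grad f xs"] by linarith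
    then have "(norm (grad f y))\<^sup>2 \<le> (?g + L * ?r)\<^sup>2" by (intro power_mono) auto
    also have "\<dots> \<le> 2 * ?g\<^sup>2 + 2 * L\<^sup>2 * ?r\<^sup>2"
      using sum_squares_bound[of ?g "L * ?r"] by (simp add: power2_sum power_mult_distrib)
    finally have 1: "(norm (grad f y))\<^sup>2 \<le> 2 * ?g\<^sup>2 + 2 * L\<^sup>2 * ?r\<^sup>2" .
    have "?T y - ?T xs = (\<Sum>i\<in>UNIV. (cov_matrix D (sgrad y) - cov_matrix D (sgrad xs)) $ i $ i)"
      by (simp add: sum_subtractf)
    also have "\<dots> \<le> (\<Sum>i\<in>(UNIV :: 'd set). L * ?r)"
      using order_trans[OF matrix_component_le_onorm lip[of y xs]]
      by (intro sum_mono) (meson abs_le_D1)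
    finally have 2: "?T y \<le> \<bar>?T xs\<bar> + ?d * L * ?r" by simp
    have "?r \<le> 1 + ?r\<^sup>2"
      using young_inequality[of 1 ?r 1] by simp
    then have "?d * L * ?r \<le> ?d * L * (1 + ?r\<^sup>2)"
      using L by (intro mult_left_mono) auto
    moreover have "(\<integral>z. (norm (sgrad y z))\<^sup>2 \<partial>D) = (norm (grad f y))\<^sup>2 + ?T y"
      using D.second_moment_eq_trace[OF sgrad_integrable, of y] by (simp add: integral_sgrad)
    moreover have "2 * ?g\<^sup>2 \<le> 2 * ?g\<^sup>2 * (1 + ?r\<^sup>2)" "2 * L\<^sup>2 * ?r\<^sup>2 \<le> 2 * L\<^sup>2 * (1 + ?r\<^sup>2)"
      "\<bar>?T xs\<bar> \<le> \<bar>?T xs\<bar> * (1 + ?r\<^sup>2)"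
      by (simp_all add: algebra_simps)
    moreover have "B * (1 + ?r\<^sup>2) = 2 * ?g\<^sup>2 * (1 + ?r\<^sup>2) + 2 * L\<^sup>2 * (1 + ?r\<^sup>2)
        + \<bar>?T xs\<bar> * (1 + ?r\<^sup>2) + ?d * L * (1 + ?r\<^sup>2)"
      unfolding B_def by (simp only: distrib_right)
    ultimately show ?thesis using 1 2 by linarith
  qed
  moreover have "B \<ge> 0" unfolding B_def using L by simp
  ultimately show ?thesis by blast
qed

section \<open>Independence of an iterate from the next sample and coin\<close>

text \<open>
The \<open>\<sigma>\<close>-algebra generated by the samples (\<open>Inl\<close>) and coins (\<open>Inr\<close>) with index in \<open>J\<close>, packaged as a
measure so that being a function of these variables is a measurability statement.
\<close>

definition samples where
  "samples J = sigma (space M) (\<Union>i\<in>J.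
     case_sum (\<lambda>n. sets (vimage_algebra (space M) (\<zeta> n) D))
              (\<lambda>n. sets (vimage_algebra (space M) (\<omega> n) (count_space UNIV))) i)"

lemma samples_generators:
  "(\<Union>i\<in>J. case_sum (\<lambda>n. sets (vimage_algebra (space M) (\<zeta> n) D))
     (\<lambda>n. sets (vimage_algebra (space M) (\<omega> n) (count_space UNIV))) i) \<subseteq> Pow (space M)"
proof (rule UN_least)
  fix i :: "nat + nat"
  show "case_sum (\<lambda>n. sets (vimage_algebra (space M) (\<zeta> n) D))
     (\<lambda>n. sets (vimage_algebra (space M) (\<omega> n) (count_space UNIV))) i \<subseteq> Pow (space M)"
  proof (cases i)
    case (Inl n)
    then show ?thesis using sets.space_closed[of "vimage_algebra (space M) (\<zeta> n) D"] by simp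
  next
    case (Inr n)
    then show ?thesis
      using sets.space_closed[of "vimage_algebra (space M) (\<omega> n) (count_space UNIV)"] by simp
  qed
qed

lemma space_samples [simp]: "space (samples J) = space M"
  unfolding samples_def by (intro space_measure_of samples_generators)

lemma sets_samples: "sets (samples J) = sigma_sets (space M) (\<Union>i\<in>J.
     case_sum (\<lambda>n. sets (vimage_algebra (space M) (\<zeta> n) D))
              (\<lambda>n. sets (vimage_algebra (space M) (\<omega> n) (count_space UNIV))) i)"
  unfolding samples_def by (intro sets_measure_of samples_generators)

lemma samples_mono: "J \<subseteq> K \<Longrightarrow> measurable (samples J) N \<subseteq> measurable (samples K) N"
  by (intro measurable_mono) (auto simp: sets_samples intro!: sigma_sets_mono')

lemma \<zeta>_samples:
  assumes "n \<ge> 1" "Inl n \<in> J" shows "\<zeta> n \<in> measurable (samples J) D"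
proof (rule measurableI)
  show "\<zeta> n w \<in> space D" if "w \<in> space (samples J)" for w
    using measurable_space[OF \<zeta>_measurable[OF assms(1)]] that by simp
  show "\<zeta> n -` S \<inter> space (samples J) \<in> sets (samples J)" if "S \<in> sets D" for S
    using that assms(2) by (auto simp: sets_samples intro!: sigma_sets.Basic bexI[of _ "Inl n"] in_vimage_algebra)
qed

lemma \<omega>_samples:
  assumes "n \<ge> 1" "Inr n \<in> J" shows "\<omega> n \<in> measurable (samples J) (count_space UNIV)"
proof (rule measurableI)
  show "\<omega> n -` S \<inter> space (samples J) \<in> sets (samples J)" for S
    using assms(2) by (auto simp: sets_samples intro!: sigma_sets.Basic bexI[of _ "Inr n"] in_vimage_algebra)
qed simp

text \<open>
Disjoint groups of independent \<open>\<sigma>\<close>-algebras generate independent \<open>\<sigma>\<close>-algebras. Index \<open>0\<close> is excluded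
because the samples and coins start at \<open>1\<close>.
\<close>

lemma indep_set_samples:
  assumes disj: "J \<inter> K = {}" and sub: "J \<union> K \<subseteq> Inl ` {1..} \<union> Inr ` {1..}"
  shows "indep_set (sets (samples J)) (sets (samples K))"
proof -
  define G where "G = case_sum (\<lambda>n. sets (vimage_algebra (space M) (\<zeta> n) D))
              (\<lambda>n. sets (vimage_algebra (space M) (\<omega> n) (count_space UNIV)))"
  have "indep_sets (\<lambda>b. sigma_sets (space M) (\<Union>i\<in>case_bool J K b. G i)) UNIV"
  proof (rule indep_sets_collect_sigma)
    show "indep_sets G (\<Union>b\<in>UNIV. case_bool J K b)"
      using sub by (intro indep_sets_mono_index[OF _ indep[folded G_def]]) (auto simp: UNIV_bool)
    show "Int_stable (G i)" for i
      by (auto simp: G_def Int_stable_def split: sum.splits)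
    show "disjoint_family_on (case_bool J K) UNIV"
      using disj by (auto simp: disjoint_family_on_def split: bool.splits)
  qed
  then show ?thesis
    unfolding indep_set_def sets_samples G_def[symmetric]
    by (rule indep_sets_mono_sets) (auto split: bool.splits)
qed

lemma measurable_samples:
  assumes "X \<in> measurable (samples J) S" and "J \<subseteq> Inl ` {1..} \<union> Inr ` {1..}"
  shows "X \<in> measurable M S"
proof -
  have "sets (samples J) \<subseteq> events"
    using indep_set_samples[of J "{}"] assms(2) by (simp add: indep_sets2_eq)
  then show ?thesis using assms(1) by (auto simp: measurable_def)
qed

lemma indep_var_samples:
  assumes X: "X \<in> measurable (samples J) S" and Y: "Y \<in> measurable (samples K) S"
    and disj: "J \<inter> K = {}" and sub: "J \<union> K \<subseteq> Inl ` {1..} \<union> Inr ` {1..}"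
  shows "indep_var S X S Y"
proof -
  have "sigma_sets (space M) {X -` A \<inter> space M |A. A \<in> sets S} \<subseteq> sets (samples J)"
    using measurable_sets[OF X] by (intro sets.sigma_sets_subset[of _ "samples J", simplified]) auto
  moreover have "sigma_sets (space M) {Y -` A \<inter> space M |A. A \<in> sets S} \<subseteq> sets (samples K)"
    using measurable_sets[OF Y] by (intro sets.sigma_sets_subset[of _ "samples K", simplified]) auto
  ultimately have "indep_set (sigma_sets (space M) {X -` A \<inter> space M |A. A \<in> sets S})
      (sigma_sets (space M) {Y -` A \<inter> space M |A. A \<in> sets S})"
    using indep_set_samples[OF disj sub] unfolding indep_sets2_eq by blast
  moreover have "random_variable S X" "random_variable S Y"
    using measurable_samples X Y sub by auto
  ultimately show ?thesis unfolding indep_var_eq by blast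
qed

definition past :: "nat \<Rightarrow> (nat + nat) set" where
  "past n = Inl ` {1..<n} \<union> Inr ` {1..<n}"

lemma proj_borel_measurable [measurable]:
  "proj_perp A \<in> borel_measurable borel" "proj_col A \<in> borel_measurable borel"
  by (intro borel_measurable_continuous_onI linear_continuous_on
      linear_conv_bounded_linear[THEN iffD1] linear_proj_perp linear_proj_col)+

text \<open>
The iterates are adapted: the \<open>n\<close>-th one is a function of the samples and coins before time \<open>n\<close>.
\<close>

lemma x_past_measurable: "n \<ge> 1 \<Longrightarrow> x n \<in> borel_measurable (samples (past n))"
proof (induction n rule: nat_induct_at_least)
  case base
  have "x 1 \<in> borel_measurable (samples (past 1)) \<longleftrightarrow> (\<lambda>w. x\<^sub>1) \<in> borel_measurable (samples (past 1))"
    by (intro measurable_cong) (simp add: x_init[unfolded One_nat_def])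
  then show ?case by simp
next
  case (Suc n)
  have [measurable]: "\<zeta> n \<in> measurable (samples (past (Suc n))) D"
    "\<omega> n \<in> measurable (samples (past (Suc n))) (count_space UNIV)"
    using Suc.hyps by (auto intro!: \<zeta>_samples \<omega>_samples simp: past_def)
  have "past n \<subseteq> past (Suc n)" by (auto simp: past_def)
  from samples_mono[OF this] Suc.IH have [measurable]: "x n \<in> borel_measurable (samples (past (Suc n)))"
    by blast
  have "x (Suc n) \<in> borel_measurable (samples (past (Suc n))) \<longleftrightarrow>
    (\<lambda>w. if \<omega> n w then proj_perp A (x n w - \<eta> n *\<^sub>R sgrad (x n w) (\<zeta> n w))
       else x n w - \<eta> n *\<^sub>R sgrad (x n w) (\<zeta> n w)) \<in> borel_measurable (samples (past (Suc n)))"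
    by (intro measurable_cong) (simp add: x_step[OF Suc.hyps] Let_def sgrad_def)
  also have "\<dots>" by measurable
  finally show ?case .
qed

lemma x_measurable: "n \<ge> 1 \<Longrightarrow> x n \<in> borel_measurable M"
  by (rule measurable_samples[OF x_past_measurable]) (auto simp: past_def)

text \<open>
Since the iterate is determined by the past, it is independent of the current sample; stated as a
product law, this lets Fubini's theorem integrate the sample out first.
\<close>

lemma distr_x_\<zeta>:
  assumes n: "n \<ge> 1"
  shows "distr M (borel \<Otimes>\<^sub>M D) (\<lambda>w. (x n w, \<zeta> n w)) = distr M borel (x n) \<Otimes>\<^sub>M D"
proof (rule pair_measure_eqI[symmetric])
  note [measurable] = x_measurable[OF n] \<zeta>_measurable[OF n]
  interpret X: prob_space "distr M borel (x n)" by (rule prob_space_distr) measurable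
  show "sigma_finite_measure (distr M borel (x n))" "sigma_finite_measure D" by unfold_locales
  show "sets (distr M borel (x n) \<Otimes>\<^sub>M D) = sets (distr M (borel \<Otimes>\<^sub>M D) (\<lambda>w. (x n w, \<zeta> n w)))"
    by (simp cong: sets_pair_measure_cong)
  fix S T assume S: "S \<in> sets (distr M borel (x n))" and T: "T \<in> sets D"
  then have [measurable]: "S \<in> sets borel" "T \<in> sets D" by auto
  have "indep_set (sets (samples (past n))) (sets (samples {Inl n}))"
    using n by (intro indep_set_samples) (auto simp: past_def)
  moreover have "x n -` S \<inter> space M \<in> sets (samples (past n))" "\<zeta> n -` T \<inter> space M \<in> sets (samples {Inl n})"
    using measurable_sets[OF x_past_measurable[OF n], of S]
      measurable_sets[OF \<zeta>_samples[OF n, of "{Inl n}"] T] S by auto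
  ultimately have "prob ((x n -` S \<inter> space M) \<inter> (\<zeta> n -` T \<inter> space M))
      = prob (x n -` S \<inter> space M) * prob (\<zeta> n -` T \<inter> space M)"
    unfolding indep_sets2_eq by blast
  moreover have "emeasure D T = emeasure M (\<zeta> n -` T \<inter> space M)"
    by (subst \<zeta>_distr[OF n, symmetric]) (simp add: emeasure_distr)
  moreover have "emeasure (distr M (borel \<Otimes>\<^sub>M D) (\<lambda>w. (x n w, \<zeta> n w))) (S \<times> T)
      = emeasure M ((x n -` S \<inter> space M) \<inter> (\<zeta> n -` T \<inter> space M))"
    by (subst emeasure_distr) (auto intro!: arg_cong[where f="emeasure M"])
  ultimately show "emeasure (distr M borel (x n)) S * emeasure D T
      = emeasure (distr M (borel \<Otimes>\<^sub>M D) (\<lambda>w. (x n w, \<zeta> n w))) (S \<times> T)"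
    by (simp add: emeasure_distr emeasure_eq_measure ennreal_mult)
qed

lemma expectation_fresh_sample:
  fixes \<phi> :: "(real^'d) \<times> 'z \<Rightarrow> real"
  assumes n: "n \<ge> 1" and \<phi>: "\<phi> \<in> borel_measurable (borel \<Otimes>\<^sub>M D)"
    and int: "integrable M (\<lambda>w. \<phi> (x n w, \<zeta> n w))"
  shows "integrable M (\<lambda>w. \<integral>z. \<phi> (x n w, z) \<partial>D)"
    and "(\<integral>w. \<phi> (x n w, \<zeta> n w) \<partial>M) = (\<integral>w. (\<integral>z. \<phi> (x n w, z) \<partial>D) \<partial>M)"
proof -
  note [measurable] = x_measurable[OF n] \<zeta>_measurable[OF n] \<phi>
  interpret P: prob_space "distr M borel (x n)" by (rule prob_space_distr) measurable
  interpret Q: pair_prob_space "distr M borel (x n)" D ..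
  have "integrable (distr M borel (x n) \<Otimes>\<^sub>M D) \<phi>"
    unfolding distr_x_\<zeta>[OF n, symmetric] using int by (subst integrable_distr_eq) auto
  note I = Q.integrable_fst'[OF this] Q.integral_fst'[OF this]
  have meas: "(\<lambda>y. \<integral>z. \<phi> (y, z) \<partial>D) \<in> borel_measurable borel" by measurable
  show "integrable M (\<lambda>w. \<integral>z. \<phi> (x n w, z) \<partial>D)"
    using I(1) meas by (subst (asm) integrable_distr_eq) auto
  have "(\<integral>w. \<phi> (x n w, \<zeta> n w) \<partial>M) = (\<integral>yz. \<phi> yz \<partial>distr M (borel \<Otimes>\<^sub>M D) (\<lambda>w. (x n w, \<zeta> n w)))"
    by (subst integral_distr) auto
  also have "\<dots> = (\<integral>y. (\<integral>z. \<phi> (y, z) \<partial>D) \<partial>distr M borel (x n))"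
    by (simp add: distr_x_\<zeta>[OF n] I(2))
  also have "\<dots> = (\<integral>w. (\<integral>z. \<phi> (x n w, z) \<partial>D) \<partial>M)"
    using meas by (subst integral_distr) auto
  finally show "(\<integral>w. \<phi> (x n w, \<zeta> n w) \<partial>M) = (\<integral>w. (\<integral>z. \<phi> (x n w, z) \<partial>D) \<partial>M)" .
qed

text \<open>
Integrability has to be established before expectations can be exchanged, hence Tonelli's theorem
for the nonnegative integral comes first.
\<close>

lemma sgrad_step_second_moment:
  assumes n: "n \<ge> 1" and int: "integrable M (\<lambda>w. (norm (x n w - xs))\<^sup>2)"
    and growth: "\<And>y. (\<integral>z. (norm (sgrad y z))\<^sup>2 \<partial>D) \<le> B * (1 + (norm (y - xs))\<^sup>2)"
  shows "integrable M (\<lambda>w. (norm (sgrad (x n w) (\<zeta> n w)))\<^sup>2)"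
    and "(\<integral>w. (norm (sgrad (x n w) (\<zeta> n w)))\<^sup>2 \<partial>M) \<le> B * (1 + (\<integral>w. (norm (x n w - xs))\<^sup>2 \<partial>M))"
proof -
  note [measurable] = x_measurable[OF n] \<zeta>_measurable[OF n]
  have bound_int: "integrable M (\<lambda>w. B * (1 + (norm (x n w - xs))\<^sup>2))" using int by simp
  let ?\<phi> = "\<lambda>yz. (norm (sgrad (fst yz) (snd yz)))\<^sup>2"
  have [measurable]: "?\<phi> \<in> borel_measurable (borel \<Otimes>\<^sub>M D)" by measurable
  have "(\<integral>\<^sup>+w. ennreal (?\<phi> (x n w, \<zeta> n w)) \<partial>M)
      = (\<integral>\<^sup>+yz. ennreal (?\<phi> yz) \<partial>distr M (borel \<Otimes>\<^sub>M D) (\<lambda>w. (x n w, \<zeta> n w)))"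
    by (subst nn_integral_distr) auto
  also have "\<dots> = (\<integral>\<^sup>+y. (\<integral>\<^sup>+z. ennreal (?\<phi> (y, z)) \<partial>D) \<partial>distr M borel (x n))"
    unfolding distr_x_\<zeta>[OF n] by (rule D.nn_integral_fst[symmetric]) simp
  also have "\<dots> = (\<integral>\<^sup>+w. (\<integral>\<^sup>+z. ennreal (?\<phi> (x n w, z)) \<partial>D) \<partial>M)"
    by (subst nn_integral_distr) auto
  also have "\<dots> = (\<integral>\<^sup>+w. ennreal (\<integral>z. (norm (sgrad (x n w) z))\<^sup>2 \<partial>D) \<partial>M)"
    by (intro nn_integral_cong) (simp add: nn_integral_eq_integral sgrad_integrable)
  also have "\<dots> \<le> (\<integral>\<^sup>+w. ennreal (B * (1 + (norm (x n w - xs))\<^sup>2)) \<partial>M)"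
    by (intro nn_integral_mono ennreal_leI growth)
  also have "\<dots> < \<infinity>"
    using integrableD(2)[OF bound_int] by (simp add: top.not_eq_extremum real_integrable_def)
  finally show I: "integrable M (\<lambda>w. (norm (sgrad (x n w) (\<zeta> n w)))\<^sup>2)"
    by (intro integrableI_nonneg) auto
  have "(\<integral>w. (norm (sgrad (x n w) (\<zeta> n w)))\<^sup>2 \<partial>M) = (\<integral>w. (\<integral>z. (norm (sgrad (x n w) z))\<^sup>2 \<partial>D) \<partial>M)"
    "integrable M (\<lambda>w. \<integral>z. (norm (sgrad (x n w) z))\<^sup>2 \<partial>D)"
    using expectation_fresh_sample[OF n, of ?\<phi>] I by auto
  then show "(\<integral>w. (norm (sgrad (x n w) (\<zeta> n w)))\<^sup>2 \<partial>M) \<le> B * (1 + (\<integral>w. (norm (x n w - xs))\<^sup>2 \<partial>M))"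
    using integral_mono[OF _ bound_int growth] int by (simp add: prob_space)
qed

lemma expectation_inner_sgrad:
  assumes n: "n \<ge> 1" and [measurable]: "h \<in> borel_measurable borel"
    and h: "integrable M (\<lambda>w. (norm (h (x n w)))\<^sup>2)"
    and g: "integrable M (\<lambda>w. (norm (sgrad (x n w) (\<zeta> n w)))\<^sup>2)"
  shows "integrable M (\<lambda>w. h (x n w) \<bullet> sgrad (x n w) (\<zeta> n w))"
    and "integrable M (\<lambda>w. h (x n w) \<bullet> grad f (x n w))"
    and "(\<integral>w. h (x n w) \<bullet> sgrad (x n w) (\<zeta> n w) \<partial>M) = (\<integral>w. h (x n w) \<bullet> grad f (x n w) \<partial>M)"
proof -
  note [measurable] = x_measurable[OF n] \<zeta>_measurable[OF n]
  show I: "integrable M (\<lambda>w. h (x n w) \<bullet> sgrad (x n w) (\<zeta> n w))"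
    by (rule integrable_inner_of_squares) (use h g in auto)
  let ?\<phi> = "\<lambda>yz. h (fst yz) \<bullet> sgrad (fst yz) (snd yz)"
  have "?\<phi> \<in> borel_measurable (borel \<Otimes>\<^sub>M D)" by measurable
  from expectation_fresh_sample[OF n this] I
  show "integrable M (\<lambda>w. h (x n w) \<bullet> grad f (x n w))"
    "(\<integral>w. h (x n w) \<bullet> sgrad (x n w) (\<zeta> n w) \<partial>M) = (\<integral>w. h (x n w) \<bullet> grad f (x n w) \<partial>M)"
    by (simp_all add: integral_sgrad sgrad_integrable)
qed

text \<open>
The coin is independent of everything that determines the half step, so the event that no
projection takes place contributes the factor \<open>1 - p n\<close>.
\<close>

lemma expectation_coin_failure:
  assumes n: "n \<ge> 1" and p: "0 \<le> p n" "p n \<le> 1"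
    and \<psi>: "\<psi> \<in> borel_measurable (samples (insert (Inl n) (past n)))" and int: "integrable M \<psi>"
  shows "integrable M (\<lambda>w. of_bool (\<not> \<omega> n w) * \<psi> w)"
    and "(\<integral>w. of_bool (\<not> \<omega> n w) * \<psi> w \<partial>M) = (1 - p n) * (\<integral>w. \<psi> w \<partial>M)"
proof -
  let ?c = "\<lambda>w. of_bool (\<not> \<omega> n w) :: real"
  note [measurable] = \<omega>_measurable[OF n]
  have "?c \<in> borel_measurable (samples {Inr n})"
    using \<omega>_samples[OF n, of "{Inr n}"] by measurable
  then have ind: "indep_var borel ?c borel \<psi>"
    by (rule indep_var_samples[OF _ \<psi>]) (use n in \<open>auto simp: past_def\<close>)
  have c: "integrable M ?c" by (rule integrable_const_bound[of _ 1]) auto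
  have "(\<integral>w. ?c w \<partial>M) = (\<integral>b. of_bool (\<not> b) \<partial>distr M (count_space UNIV) (\<omega> n))"
    by (subst integral_distr) auto
  also have "\<dots> = 1 - p n"
    unfolding \<omega>_distr[OF n] using p by (subst integral_bernoulli_pmf) auto
  finally have "(\<integral>w. ?c w \<partial>M) = 1 - p n" .
  then show "(\<integral>w. ?c w * \<psi> w \<partial>M) = (1 - p n) * (\<integral>w. \<psi> w \<partial>M)"
    using indep_var_lebesgue_integral[OF ind c int] by simp
  show "integrable M (\<lambda>w. ?c w * \<psi> w)" by (rule indep_var_integrable[OF ind c int])
qed

text \<open>
The null-space component takes the same step whether or not the projection is applied, so the coin
appears only in the estimate for the column component. The martingale property of the noise enters
through \<open>grad f\<close> replacing the stochastic gradient in the inner products.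
\<close>

lemma one_step_moments:
  assumes n: "n \<ge> 1" and p: "0 \<le> p n" "p n \<le> 1" and xs: "transpose A *v xs = 0"
    and growth: "\<And>y. (\<integral>z. (norm (sgrad y z))\<^sup>2 \<partial>D) \<le> B * (1 + (norm (y - xs))\<^sup>2)"
    and U: "integrable M (\<lambda>w. (norm (proj_perp A (x n w) - xs))\<^sup>2)"
    and V: "integrable M (\<lambda>w. (norm (proj_col A (x n w)))\<^sup>2)"
  defines "Q \<equiv> B * (1 + (\<integral>w. (norm (proj_perp A (x n w) - xs))\<^sup>2 \<partial>M) + (\<integral>w. (norm (proj_col A (x n w)))\<^sup>2 \<partial>M))"
  shows "integrable M (\<lambda>w. (norm (proj_perp A (x (Suc n) w) - xs))\<^sup>2)"
    and "integrable M (\<lambda>w. (norm (proj_col A (x (Suc n) w)))\<^sup>2)"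
    and "integrable M (\<lambda>w. (proj_perp A (x n w) - xs) \<bullet> grad f (x n w))"
    and "integrable M (\<lambda>w. proj_col A (x n w) \<bullet> grad f (x n w))"
    and "(\<integral>w. (norm (proj_perp A (x (Suc n) w) - xs))\<^sup>2 \<partial>M)
      \<le> (\<integral>w. (norm (proj_perp A (x n w) - xs))\<^sup>2 \<partial>M)
        - 2 * \<eta> n * (\<integral>w. (proj_perp A (x n w) - xs) \<bullet> grad f (x n w) \<partial>M) + (\<eta> n)\<^sup>2 * Q"
    and "(\<integral>w. (norm (proj_col A (x (Suc n) w)))\<^sup>2 \<partial>M)
      \<le> (1 - p n) * ((\<integral>w. (norm (proj_col A (x n w)))\<^sup>2 \<partial>M)
        - 2 * \<eta> n * (\<integral>w. proj_col A (x n w) \<bullet> grad f (x n w) \<partial>M) + (\<eta> n)\<^sup>2 * Q)"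
proof -
  note [measurable] = x_measurable[OF n] \<zeta>_measurable[OF n] \<omega>_measurable[OF n]
  let ?e = "\<lambda>w. proj_perp A (x n w) - xs" and ?v = "\<lambda>w. proj_col A (x n w)"
  let ?g = "\<lambda>w. sgrad (x n w) (\<zeta> n w)"
  have null: "transpose A *v (proj_perp A y - xs) = 0" for y
    using xs proj_perp_in_null[of A y]
    by (simp del: transpose_matrix_vector add: matrix_vector_mult_diff_distrib)
  have dist_eq: "(norm (x n w - xs))\<^sup>2 = (norm (?e w))\<^sup>2 + (norm (?v w))\<^sup>2" for w
    using pythagoras_proj[of "x n w - xs" A]
    by (simp add: linear_diff[OF linear_proj_perp] linear_diff[OF linear_proj_col] proj_perp_null[OF xs] proj_col_null[OF xs])
  have dist_int: "integrable M (\<lambda>w. (norm (x n w - xs))\<^sup>2)" unfolding dist_eq using U V by simp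
  have g_int: "integrable M (\<lambda>w. (norm (?g w))\<^sup>2)" and g_le: "(\<integral>w. (norm (?g w))\<^sup>2 \<partial>M) \<le> Q"
    using sgrad_step_second_moment[OF n dist_int growth] U V by (auto simp: dist_eq Q_def add.assoc)
  note E = expectation_inner_sgrad[OF n _ U g_int]
  note Vv = expectation_inner_sgrad[OF n _ V g_int]
  have Pg_int: "integrable M (\<lambda>w. (norm (proj_perp A (?g w)))\<^sup>2)" "integrable M (\<lambda>w. (norm (proj_col A (?g w)))\<^sup>2)"
    by (rule Bochner_Integration.integrable_bound[OF g_int]; auto intro!: power_mono norm_proj_le)+
  have Pg_le: "(\<integral>w. (norm (proj_perp A (?g w)))\<^sup>2 \<partial>M) \<le> Q" "(\<integral>w. (norm (proj_col A (?g w)))\<^sup>2 \<partial>M) \<le> Q"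
    by (rule order_trans[OF integral_mono[OF _ g_int] g_le]; use Pg_int in \<open>auto intro!: power_mono norm_proj_le\<close>)+
  have u_eq: "(norm (proj_perp A (x (Suc n) w) - xs))\<^sup>2
      = (norm (?e w))\<^sup>2 - 2 * \<eta> n * (?e w \<bullet> ?g w) + (\<eta> n)\<^sup>2 * (norm (proj_perp A (?g w)))\<^sup>2"
    if "w \<in> space M" for w
  proof -
    have "proj_perp A (x (Suc n) w) = proj_perp A (x n w) - \<eta> n *\<^sub>R proj_perp A (?g w)"
      using x_step[OF n that]
      by (auto simp: Let_def sgrad_def proj_perp_proj_perp linear_diff[OF linear_proj_perp] linear_scale[OF linear_proj_perp])
    then have "proj_perp A (x (Suc n) w) - xs = ?e w - \<eta> n *\<^sub>R proj_perp A (?g w)" by simp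
    also have "(norm \<dots>)\<^sup>2 = (norm (?e w))\<^sup>2 - 2 * \<eta> n * (?e w \<bullet> proj_perp A (?g w)) + (\<eta> n)\<^sup>2 * (norm (proj_perp A (?g w)))\<^sup>2"
      unfolding power2_norm_eq_inner by (simp add: inner_diff_left inner_diff_right inner_commute power2_eq_square algebra_simps)
    finally show ?thesis by (simp add: inner_proj_perp[OF null])
  qed
  let ?\<psi> = "\<lambda>w. (norm (?v w - \<eta> n *\<^sub>R proj_col A (?g w)))\<^sup>2"
  have \<psi>_eq: "?\<psi> w = (norm (?v w))\<^sup>2 - 2 * \<eta> n * (?v w \<bullet> ?g w) + (\<eta> n)\<^sup>2 * (norm (proj_col A (?g w)))\<^sup>2" for w
  proof -
    have "?\<psi> w = (norm (?v w))\<^sup>2 - 2 * \<eta> n * (?v w \<bullet> proj_col A (?g w)) + (\<eta> n)\<^sup>2 * (norm (proj_col A (?g w)))\<^sup>2"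
      unfolding power2_norm_eq_inner by (simp add: inner_diff_left inner_diff_right inner_commute power2_eq_square algebra_simps)
    then show ?thesis by (simp add: inner_proj_col)
  qed
  have v_eq: "(norm (proj_col A (x (Suc n) w)))\<^sup>2 = of_bool (\<not> \<omega> n w) * ?\<psi> w" if "w \<in> space M" for w
    using x_step[OF n that]
    by (auto simp: Let_def sgrad_def proj_col_proj_perp linear_diff[OF linear_proj_col] linear_scale[OF linear_proj_col])
  show "integrable M (\<lambda>w. (proj_perp A (x n w) - xs) \<bullet> grad f (x n w))"
    "integrable M (\<lambda>w. proj_col A (x n w) \<bullet> grad f (x n w))"
    using E(2) Vv(2) by measurable
  have u_int: "integrable M (\<lambda>w. (norm (?e w))\<^sup>2 - 2 * \<eta> n * (?e w \<bullet> ?g w) + (\<eta> n)\<^sup>2 * (norm (proj_perp A (?g w)))\<^sup>2)"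
    using U E(1) Pg_int by simp
  then show "integrable M (\<lambda>w. (norm (proj_perp A (x (Suc n) w) - xs))\<^sup>2)"
    using u_eq by (simp cong: Bochner_Integration.integrable_cong)
  have "(\<integral>w. (norm (proj_perp A (x (Suc n) w) - xs))\<^sup>2 \<partial>M)
     = (\<integral>w. (norm (?e w))\<^sup>2 - 2 * \<eta> n * (?e w \<bullet> ?g w) + (\<eta> n)\<^sup>2 * (norm (proj_perp A (?g w)))\<^sup>2 \<partial>M)"
    using u_eq by (simp cong: Bochner_Integration.integral_cong)
  also have "\<dots> = (\<integral>w. (norm (?e w))\<^sup>2 \<partial>M) - 2 * \<eta> n * (\<integral>w. ?e w \<bullet> grad f (x n w) \<partial>M)
      + (\<eta> n)\<^sup>2 * (\<integral>w. (norm (proj_perp A (?g w)))\<^sup>2 \<partial>M)"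
    using U E(1) Pg_int by (simp add: E(3)[symmetric])
  also have "\<dots> \<le> (\<integral>w. (norm (?e w))\<^sup>2 \<partial>M) - 2 * \<eta> n * (\<integral>w. ?e w \<bullet> grad f (x n w) \<partial>M) + (\<eta> n)\<^sup>2 * Q"
    using Pg_le(1) by (intro add_left_mono mult_left_mono) auto
  finally show "(\<integral>w. (norm (proj_perp A (x (Suc n) w) - xs))\<^sup>2 \<partial>M) \<le> \<dots>" .
  have \<psi>_int: "integrable M ?\<psi>" unfolding \<psi>_eq using V Vv(1) Pg_int by simp
  have \<psi>_meas: "?\<psi> \<in> borel_measurable (samples (insert (Inl n) (past n)))"
  proof -
    have [measurable]: "x n \<in> borel_measurable (samples (insert (Inl n) (past n)))"
      using x_past_measurable[OF n] samples_mono[of "past n" "insert (Inl n) (past n)"] by blast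
    have [measurable]: "\<zeta> n \<in> measurable (samples (insert (Inl n) (past n))) D"
      using n by (intro \<zeta>_samples) auto
    show ?thesis by measurable
  qed
  note C = expectation_coin_failure[OF n p \<psi>_meas \<psi>_int]
  show "integrable M (\<lambda>w. (norm (proj_col A (x (Suc n) w)))\<^sup>2)"
    using C(1) v_eq by (simp cong: Bochner_Integration.integrable_cong)
  have "(\<integral>w. (norm (proj_col A (x (Suc n) w)))\<^sup>2 \<partial>M) = (1 - p n) * (\<integral>w. ?\<psi> w \<partial>M)"
    using C(2) v_eq by (simp cong: Bochner_Integration.integral_cong)
  also have "(\<integral>w. ?\<psi> w \<partial>M) = (\<integral>w. (norm (?v w))\<^sup>2 \<partial>M) - 2 * \<eta> n * (\<integral>w. ?v w \<bullet> grad f (x n w) \<partial>M)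
      + (\<eta> n)\<^sup>2 * (\<integral>w. (norm (proj_col A (?g w)))\<^sup>2 \<partial>M)"
    unfolding \<psi>_eq using V Vv(1) Pg_int by (simp add: Vv(3)[symmetric])
  also have "(1 - p n) * \<dots> \<le> (1 - p n) * ((\<integral>w. (norm (?v w))\<^sup>2 \<partial>M)
     - 2 * \<eta> n * (\<integral>w. ?v w \<bullet> grad f (x n w) \<partial>M) + (\<eta> n)\<^sup>2 * Q)"
    using Pg_le(2) p by (intro add_left_mono mult_left_mono) auto
  finally show "(\<integral>w. (norm (proj_col A (x (Suc n) w)))\<^sup>2 \<partial>M) \<le> \<dots>" .
qed

section \<open>Mean-square recursions and rates\<close>

lemma iterates_square_integrable:
  assumes n: "n \<ge> 1" and p: "\<And>n. n \<ge> 1 \<Longrightarrow> 0 \<le> p n \<and> p n \<le> 1" and xs: "transpose A *v xs = 0"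
    and growth: "\<And>y. (\<integral>z. (norm (sgrad y z))\<^sup>2 \<partial>D) \<le> B * (1 + (norm (y - xs))\<^sup>2)"
  shows "integrable M (\<lambda>w. (norm (proj_perp A (x n w) - xs))\<^sup>2) \<and>
    integrable M (\<lambda>w. (norm (proj_col A (x n w)))\<^sup>2)"
  using n
proof (induction n rule: nat_induct_at_least)
  case base
  then show ?case
    using x_init by (simp cong: Bochner_Integration.integrable_cong)
next
  case (Suc n)
  then show ?case using one_step_moments(1,2)[OF Suc.hyps _ _ xs growth] p by blast
qed

text \<open>
The two smallness conditions let the surplus contraction absorb every term of second order in the
step or first order in \<open>\<eta> / p\<close> that is proportional to \<open>U\<close> or \<open>V\<close>: half of \<open>\<mu> \<eta>\<close> does so for the
null-space component, and a quarter of \<open>p\<close> for the column component. They hold eventually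
because \<open>\<eta>\<close> and \<open>\<eta> / p\<close> tend to \<open>0\<close>.
\<close>

lemma mean_square_recursion:
  assumes n: "n \<ge> 1" and p: "0 < p n" "p n \<le> 1" and \<eta>: "0 \<le> \<eta> n"
    and min: "is_arg_min f (\<lambda>y. transpose A *v y = 0) xs"
    and smooth: "\<And>y z. norm (grad f y - grad f z) \<le> L * norm (y - z)"
    and L: "L \<ge> 0" and mu: "\<mu> > 0"
    and sc: "\<And>y z. f y - f z \<ge> grad f z \<bullet> (y - z) + \<mu> / 2 * (norm (y - z))\<^sup>2"
    and growth: "\<And>y. (\<integral>z. (norm (sgrad y z))\<^sup>2 \<partial>D) \<le> B * (1 + (norm (y - xs))\<^sup>2)"
    and B: "B \<ge> 0"
    and U_int: "integrable M (\<lambda>w. (norm (proj_perp A (x n w) - xs))\<^sup>2)"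
    and V_int: "integrable M (\<lambda>w. (norm (proj_col A (x n w)))\<^sup>2)"
    and small_u: "B * \<eta> n \<le> \<mu> / 2" and small_v: "2 * L * \<eta> n + B * (\<eta> n)\<^sup>2 \<le> p n / 4"
  defines "U \<equiv> \<lambda>n. \<integral>w. (norm (proj_perp A (x n w) - xs))\<^sup>2 \<partial>M"
    and "V \<equiv> \<lambda>n. \<integral>w. (norm (proj_col A (x n w)))\<^sup>2 \<partial>M"
    and "C \<equiv> 2 * L\<^sup>2 / \<mu> + \<mu> / 2 + B + 8 * (norm (grad f xs))\<^sup>2 + 8 * L\<^sup>2"
  shows "U (Suc n) \<le> (1 - \<mu> * \<eta> n) * U n + C * \<eta> n * V n + C * (\<eta> n)\<^sup>2"
    and "V (Suc n) \<le> (1 - p n / 2) * V n + C * p n * (\<eta> n / p n)\<^sup>2 * (1 + U n)"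
proof -
  let ?g = "norm (grad f xs)"
  let ?Q = "B * (1 + U n + V n)"
  have xs: "transpose A *v xs = 0" using min by (simp add: is_arg_min_def)
  note S = one_step_moments[OF n less_imp_le[OF p(1)] p(2) xs growth U_int V_int]
  have nonneg: "U n \<ge> 0" "V n \<ge> 0" by (simp_all add: U_def V_def)
  have C_ge: "2 * L\<^sup>2 / \<mu> + \<mu> / 2 \<le> C" "B \<le> C" "8 * ?g\<^sup>2 + 8 * L\<^sup>2 + B \<le> C"
    using B mu by (simp_all add: C_def)

  have "3 / 4 * \<mu> * U n - L\<^sup>2 / \<mu> * V n = (\<integral>w. 3 / 4 * \<mu> * (norm (proj_perp A (x n w) - xs))\<^sup>2
      - L\<^sup>2 / \<mu> * (norm (proj_col A (x n w)))\<^sup>2 \<partial>M)"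
    using U_int V_int by (simp add: U_def V_def)
  also have "\<dots> \<le> (\<integral>w. (proj_perp A (x n w) - xs) \<bullet> grad f (x n w) \<partial>M)"
    using U_int V_int S(3) by (intro integral_mono perp_descent[OF min f_differentiable smooth mu sc]) auto
  finally have "2 * \<eta> n * (3 / 4 * \<mu> * U n - L\<^sup>2 / \<mu> * V n)
      \<le> 2 * \<eta> n * (\<integral>w. (proj_perp A (x n w) - xs) \<bullet> grad f (x n w) \<partial>M)"
    using \<eta> by (intro mult_left_mono) auto
  with S(5) have "U (Suc n) \<le> U n - 2 * \<eta> n * (3 / 4 * \<mu> * U n - L\<^sup>2 / \<mu> * V n) + (\<eta> n)\<^sup>2 * ?Q"
    unfolding U_def V_def by linarith
  also have "\<dots> = (1 - \<mu> * \<eta> n) * U n - \<mu> / 2 * \<eta> n * U n + 2 * L\<^sup>2 / \<mu> * \<eta> n * V n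
      + (B * \<eta> n) * (\<eta> n * (U n + V n)) + B * (\<eta> n)\<^sup>2"
    by (simp add: algebra_simps power2_eq_square)
  also have "(B * \<eta> n) * (\<eta> n * (U n + V n)) \<le> \<mu> / 2 * (\<eta> n * (U n + V n))"
    using small_u \<eta> nonneg by (intro mult_right_mono) auto
  also have "(1 - \<mu> * \<eta> n) * U n - \<mu> / 2 * \<eta> n * U n + 2 * L\<^sup>2 / \<mu> * \<eta> n * V n
      + \<mu> / 2 * (\<eta> n * (U n + V n)) + B * (\<eta> n)\<^sup>2
      = (1 - \<mu> * \<eta> n) * U n + (2 * L\<^sup>2 / \<mu> + \<mu> / 2) * (\<eta> n * V n) + B * (\<eta> n)\<^sup>2"
    by (simp add: algebra_simps)
  also have "\<dots> \<le> (1 - \<mu> * \<eta> n) * U n + C * (\<eta> n * V n) + C * (\<eta> n)\<^sup>2"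
    using C_ge \<eta> nonneg by (intro add_mono mult_right_mono) auto
  finally show "U (Suc n) \<le> (1 - \<mu> * \<eta> n) * U n + C * \<eta> n * V n + C * (\<eta> n)\<^sup>2"
    by (simp add: mult.assoc)

  have "- 2 * \<eta> n * (\<integral>w. proj_col A (x n w) \<bullet> grad f (x n w) \<partial>M)
      = (\<integral>w. - 2 * \<eta> n * (proj_col A (x n w) \<bullet> grad f (x n w)) \<partial>M)"
    by simp
  also have "\<dots> \<le> (\<integral>w. (p n / 4 + 2 * L * \<eta> n) * (norm (proj_col A (x n w)))\<^sup>2
     + 8 * (\<eta> n)\<^sup>2 / p n * (?g\<^sup>2 + L\<^sup>2 * (norm (proj_perp A (x n w) - xs))\<^sup>2) \<partial>M)"
    using U_int V_int S(4) \<eta> by (intro integral_mono col_drift[OF smooth L p(1)]) auto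
  also have "\<dots> = (p n / 4 + 2 * L * \<eta> n) * V n + 8 * (\<eta> n)\<^sup>2 / p n * (?g\<^sup>2 + L\<^sup>2 * U n)"
    using U_int V_int by (simp add: U_def V_def prob_space)
  finally have drift: "- 2 * \<eta> n * (\<integral>w. proj_col A (x n w) \<bullet> grad f (x n w) \<partial>M)
      \<le> (p n / 4 + 2 * L * \<eta> n) * V n + 8 * (\<eta> n)\<^sup>2 / p n * (?g\<^sup>2 + L\<^sup>2 * U n)" .
  \<comment> \<open>The noise is of order \<open>\<eta>\<^sup>2\<close>, which \<open>p \<le> 1\<close> allows to be merged with the drift of order \<open>\<eta>\<^sup>2 / p\<close>.\<close>
  define R where "R = (\<eta> n)\<^sup>2 / p n"
  have R: "R \<ge> 0" "(\<eta> n)\<^sup>2 \<le> R" "R = p n * (\<eta> n / p n)\<^sup>2"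
  proof -
    show "R \<ge> 0" using p by (simp add: R_def)
    show "(\<eta> n)\<^sup>2 \<le> R" using p by (simp add: R_def pos_le_divide_eq mult_left_le)
    show "R = p n * (\<eta> n / p n)\<^sup>2" using p by (simp add: R_def power2_eq_square)
  qed
  have "V n - 2 * \<eta> n * (\<integral>w. proj_col A (x n w) \<bullet> grad f (x n w) \<partial>M) + (\<eta> n)\<^sup>2 * ?Q
      \<le> V n + (p n / 4 + 2 * L * \<eta> n) * V n + 8 * R * (?g\<^sup>2 + L\<^sup>2 * U n) + (\<eta> n)\<^sup>2 * ?Q"
    using drift by (simp add: R_def)
  also have "\<dots> = V n + p n / 4 * V n + (2 * L * \<eta> n + B * (\<eta> n)\<^sup>2) * V n
      + R * (8 * ?g\<^sup>2 + 8 * L\<^sup>2 * U n) + (\<eta> n)\<^sup>2 * (B * (1 + U n))"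
    by (simp add: algebra_simps)
  also have "(2 * L * \<eta> n + B * (\<eta> n)\<^sup>2) * V n \<le> p n / 4 * V n"
    using small_v nonneg by (intro mult_right_mono) auto
  also have "(\<eta> n)\<^sup>2 * (B * (1 + U n)) \<le> R * (B * (1 + U n))"
    using R B nonneg by (intro mult_right_mono) auto
  also have "R * (8 * ?g\<^sup>2 + 8 * L\<^sup>2 * U n) \<le> R * ((8 * ?g\<^sup>2 + 8 * L\<^sup>2) * (1 + U n))"
    using R nonneg by (intro mult_left_mono) (auto simp: algebra_simps)
  finally have "V n - 2 * \<eta> n * (\<integral>w. proj_col A (x n w) \<bullet> grad f (x n w) \<partial>M) + (\<eta> n)\<^sup>2 * ?Q
      \<le> (1 + p n / 2) * V n + R * ((8 * ?g\<^sup>2 + 8 * L\<^sup>2 + B) * (1 + U n))"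
    by (simp add: algebra_simps)
  also have "\<dots> \<le> (1 + p n / 2) * V n + R * (C * (1 + U n))"
    using C_ge R nonneg by (intro add_left_mono mult_left_mono mult_right_mono) auto
  finally have "(1 - p n) * (V n - 2 * \<eta> n * (\<integral>w. proj_col A (x n w) \<bullet> grad f (x n w) \<partial>M) + (\<eta> n)\<^sup>2 * ?Q)
      \<le> (1 - p n) * ((1 + p n / 2) * V n + R * (C * (1 + U n)))"
    using p by (intro mult_left_mono) auto
  with S(6) have "V (Suc n) \<le> (1 - p n) * ((1 + p n / 2) * V n + R * (C * (1 + U n)))"
    unfolding U_def V_def by linarith
  also have "\<dots> = (1 - p n) * (1 + p n / 2) * V n + (1 - p n) * (R * (C * (1 + U n)))"
    by (simp add: distrib_left)
  also have "(1 - p n) * (1 + p n / 2) * V n \<le> (1 - p n / 2) * V n"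
    using nonneg p by (intro mult_right_mono) (auto simp: algebra_simps)
  also have "(1 - p n) * (R * (C * (1 + U n))) \<le> R * (C * (1 + U n))"
    using p R nonneg C_ge B by (intro mult_left_le_one_le mult_nonneg_nonneg) auto
  finally show "V (Suc n) \<le> (1 - p n / 2) * V n + C * p n * (\<eta> n / p n)\<^sup>2 * (1 + U n)"
    unfolding R(3) by (simp add: mult_ac)
qed

end

theorem theorem3p1:
  fixes M :: "'w measure" and D :: "'z measure"
    and A :: "real^'m^'d"
    and F :: "real^'d \<Rightarrow> 'z \<Rightarrow> real" and f :: "real^'d \<Rightarrow> real"
    and \<eta> p :: "nat \<Rightarrow> real"
    and \<zeta> :: "nat \<Rightarrow> 'w \<Rightarrow> 'z" and \<omega> :: "nat \<Rightarrow> 'w \<Rightarrow> bool"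
    and x\<^sub>1 xstar :: "real^'d" and x :: "nat \<Rightarrow> 'w \<Rightarrow> real^'d"
    and \<Sigma> :: "real^'d \<Rightarrow> real^'d^'d"
    and L \<mu> \<alpha> \<beta> \<gamma> \<eta>\<^sub>0 :: real
  assumes lpsa: "lpsa M D A F f \<eta> p \<zeta> \<omega> x\<^sub>1 x"
    and xstar: "is_arg_min f (\<lambda>y. transpose A *v y = 0) xstar"
    and grad_xstar: "grad f xstar \<noteq> 0"
    and smooth: "\<And>y z. norm (grad f y - grad f z) \<le> L * norm (y - z)"
    and mu_pos: "\<mu> > 0"
    and strongly_convex: "\<And>y z. f y - f z \<ge> grad f z \<bullet> (y - z) + \<mu> / 2 * (norm (y - z))\<^sup>2"
    and Sigma_def: "\<And>y. \<Sigma> y = cov_matrix D (\<lambda>z. grad (\<lambda>y. F y z) y)"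
    and Sigma_lipschitz: "\<And>y z. onorm ((*v) (\<Sigma> y - \<Sigma> z)) \<le> L * norm (y - z)"
    and eta: "\<And>n. n \<ge> 1 \<Longrightarrow> \<eta> n = \<eta>\<^sub>0 * real n powr (-\<alpha>)"
    and p: "\<And>n. n \<ge> 1 \<Longrightarrow> p n = min (\<gamma> * \<eta> n powr \<beta>) 1"
    and gamma_pos: "\<gamma> > 0"
    and alpha: "0 < \<alpha>" "\<alpha> \<le> 1"
    and beta: "0 \<le> \<beta>" "\<beta> < 1"
    and eta0: "\<eta>\<^sub>0 > 0" "\<eta>\<^sub>0 > 2 * of_bool (\<alpha> = 1) / \<mu>"
  shows "(\<forall>n\<ge>1. integrable M (\<lambda>w. (norm (proj_perp A (x n w) - xstar))\<^sup>2)) \<and>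
         (\<lambda>n. \<integral>w. (norm (proj_perp A (x n w) - xstar))\<^sup>2 \<partial>M)
           \<in> O(\<lambda>n. real n powr (-\<alpha> * min 1 (2 - 2 * \<beta>))) \<and>
         (\<forall>n\<ge>1. integrable M (\<lambda>w. (norm (proj_col A (x n w)))\<^sup>2)) \<and>
         (\<lambda>n. \<integral>w. (norm (proj_col A (x n w)))\<^sup>2 \<partial>M)
           \<in> O(\<lambda>n. real n powr (-2 * \<alpha> * (1 - \<beta>)))"
proof -
  interpret lpsa M D A F f \<eta> p \<zeta> \<omega> x\<^sub>1 x by (rule lpsa)
  define c where "c = min (\<gamma> * \<eta>\<^sub>0 powr \<beta>) 1"
  have c: "c > 0" using gamma_pos eta0(1) by (simp add: c_def)
  have p_ge: "c * real n powr (- \<alpha> * \<beta>) \<le> p n" if "n \<ge> 1" for n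
    unfolding c_def p[OF that] eta[OF that] using alpha beta eta0 that
    by (intro min_power_step_lower_bound) auto
  have steps: "\<And>n. n \<ge> 1 \<Longrightarrow> \<eta> n > 0" "\<And>n. n \<ge> 1 \<Longrightarrow> p n > 0"
    "\<eta> \<longlonglongrightarrow> 0" "(\<lambda>n. \<eta> n / p n) \<longlonglongrightarrow> 0"
    using power_step_sizes[OF eta p_ge c alpha(1) beta(2) eta0(1)] by blast+
  have p_le: "p n \<le> 1" if "n \<ge> 1" for n using p[OF that] by simp
  have xs: "transpose A *v xstar = 0" using xstar by (simp add: is_arg_min_def)
  \<comment> \<open>Passing to \<open>\<bar>L\<bar>\<close> supplies a nonnegative constant, as \<open>col_drift\<close> needs.\<close>
  have smooth': "norm (grad f y - grad f z) \<le> \<bar>L\<bar> * norm (y - z)" for y z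
    by (rule order_trans[OF smooth]) (auto intro: mult_right_mono)
  have lip': "onorm ((*v) (cov_matrix D (sgrad y) - cov_matrix D (sgrad z))) \<le> \<bar>L\<bar> * norm (y - z)" for y z
  proof -
    have "onorm ((*v) (cov_matrix D (sgrad y) - cov_matrix D (sgrad z))) \<le> L * norm (y - z)"
      using Sigma_lipschitz[of y z] by (simp add: Sigma_def sgrad_def[abs_def])
    also have "\<dots> \<le> \<bar>L\<bar> * norm (y - z)" by (intro mult_right_mono) auto
    finally show ?thesis .
  qed
  obtain B where B: "B \<ge> 0"
    and growth: "\<And>y. (\<integral>z. (norm (sgrad y z))\<^sup>2 \<partial>D) \<le> B * (1 + (norm (y - xstar))\<^sup>2)"
    using second_moment_growth[OF smooth' lip', of xstar] by auto
  have int: "integrable M (\<lambda>w. (norm (proj_perp A (x n w) - xstar))\<^sup>2)"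
    "integrable M (\<lambda>w. (norm (proj_col A (x n w)))\<^sup>2)" if "n \<ge> 1" for n
    using iterates_square_integrable[OF that _ xs growth] steps(2) p_le by (auto intro: less_imp_le)
  define U where "U n = (\<integral>w. (norm (proj_perp A (x n w) - xstar))\<^sup>2 \<partial>M)" for n
  define V where "V n = (\<integral>w. (norm (proj_col A (x n w)))\<^sup>2 \<partial>M)" for n
  define C where "C = 2 * \<bar>L\<bar>\<^sup>2 / \<mu> + \<mu> / 2 + B + 8 * (norm (grad f xstar))\<^sup>2 + 8 * \<bar>L\<bar>\<^sup>2"
  have small_u: "\<forall>\<^sub>F n in sequentially. B * \<eta> n < \<mu> / 2"
    using order_tendstoD(2)[OF tendsto_mult_right_zero[OF steps(3), of B], of "\<mu> / 2"] mu_pos by simp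
  have "(\<lambda>n. 2 * \<bar>L\<bar> * (\<eta> n / p n) + B * (\<eta> n * (\<eta> n / p n))) \<longlonglongrightarrow> 0"
    by (intro tendsto_add_zero tendsto_mult_right_zero tendsto_mult_zero steps(3) steps(4))
  then have small_v: "\<forall>\<^sub>F n in sequentially. 2 * \<bar>L\<bar> * (\<eta> n / p n) + B * (\<eta> n * (\<eta> n / p n)) < 1 / 4"
    by (rule order_tendstoD(2)) simp
  have rec: "\<forall>\<^sub>F n in sequentially.
      U (Suc n) \<le> (1 - \<mu> * \<eta> n) * U n + C * \<eta> n * V n + C * (\<eta> n)\<^sup>2 \<and>
      V (Suc n) \<le> (1 - p n / 2) * V n + C * p n * (\<eta> n / p n)\<^sup>2 * (1 + U n)"
    using small_u small_v eventually_ge_at_top[of 1]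
  proof eventually_elim
    case (elim n)
    then have n: "n \<ge> 1" by simp
    have "p n * (2 * \<bar>L\<bar> * (\<eta> n / p n) + B * (\<eta> n * (\<eta> n / p n))) \<le> p n * (1 / 4)"
      using elim steps(2)[OF n] by (intro mult_left_mono) auto
    also have "p n * (2 * \<bar>L\<bar> * (\<eta> n / p n) + B * (\<eta> n * (\<eta> n / p n))) = 2 * \<bar>L\<bar> * \<eta> n + B * (\<eta> n)\<^sup>2"
      using steps(2)[OF n] by (simp add: field_simps power2_eq_square)
    finally have "2 * \<bar>L\<bar> * \<eta> n + B * (\<eta> n)\<^sup>2 \<le> p n / 4" by simp
    with elim show ?case
      unfolding U_def V_def C_def
      by (intro conjI mean_square_recursion[OF n steps(2)[OF n] p_le[OF n] less_imp_le[OF steps(1)[OF n]]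
            xstar smooth' abs_ge_zero mu_pos strongly_convex growth B int[OF n]]) auto
  qed
  have "C > 0"
    using mu_pos B by (simp add: C_def add_pos_nonneg add_nonneg_pos)
  moreover have "\<mu> * \<eta>\<^sub>0 > 1" if "\<alpha> = 1"
    using eta0(2) mu_pos that by (simp add: pos_divide_less_eq mult.commute)
  ultimately have "U \<in> O(\<lambda>n. real n powr (-\<alpha> * min 1 (2 - 2 * \<beta>)))"
    "V \<in> O(\<lambda>n. real n powr (-2 * \<alpha> * (1 - \<beta>)))"
    using mu_pos rec eta p_le p_ge c alpha beta eta0(1)
    by (intro coupled_recursion_rates[of \<mu> C U V \<eta> p \<eta>\<^sub>0 \<alpha> c \<beta>];
        auto simp: U_def V_def eventually_conj_iff)+
  then show ?thesis
    unfolding U_def[abs_def] V_def[abs_def] using int by blast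
qed

end
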